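(* Let $\Bbbk$ be a field of characteristic zero and $R=\Bbbk[x_1,\ldots,x_n]$. The following algorithm is correct. Input: a prime ideal $\mathfrak p\in\mathrm{Spec}(R)$, with residue field $\mathbb F=R_{\mathfrak p}/\mathfrak pR_{\mathfrak p}$, and a set of differential operators $\delta_1,\ldots,\delta_m\in(D_n)^r$. Output: the $\mathfrak p$-primary $R$-submodule $\{w\in R^r\mid\delta(w)\in\mathfrak p\text{ for all }\delta\in\mathcal G\}$ of $R^r$, where $\mathcal G\subseteq(D_n)^r$ is the $R$-bimodule generated by $\delta_1,\ldots,\delta_m$. (1) Compute $A_1=\Psi^{-1}(\Phi(\delta_1)),\ldots,A_m=\Psi^{-1}(\Phi(\delta_m))\in\mathbb F[z_1,\ldots,z_n]^r$. (2) Using linear algebra over $\mathbb F$, compute the inverse system $$\mathbb V=(A_1,\ldots,A_m)^\perp=\{v\in\mathbb F[[y_1,\ldots,y_n]]^r\mid v\cdot A_i=0\text{ for all }1\le i\le m\}.$$ (3) Return the $R$-submodule $\Gamma^{-1}(\mathbb V)\subseteq R^r$. That is, $\Gamma^{-1}(\mathbb V)=\{w\in R^r\mid\delta(w)\in\mathfrak p\text{ for all }\delta\in\mathcal G\}$, and this is a $\mathfrak p$-primary $R$-submodule of $R^r$.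
   Context: $D_n=R\langle\partial_{x_1},\ldots,\partial_{x_n}\rangle$ is the Weyl algebra; $\delta=(\delta^{(1)},\ldots,\delta^{(r)})\in(D_n)^r$ acts as a differential operator $R^r\to R$ by $\delta(w)=\sum_j\delta^{(j)}(w_j)$. $(D_n)^r$ is an $R$-bimodule by left and right multiplication. A submodule $N\subseteq R^r$ is $\mathfrak p$-primary if $\mathrm{Ass}_R(R^r/N)=\{\mathfrak p\}$. $\Phi:(D_n)^r\to\mathbb F\otimes_R(D_n)^r$ is the canonical map $\delta\mapsto1\otimes\delta$, where $\mathbb F\otimes_RD_n=\bigoplus_{\alpha\in\mathbb N^n}\mathbb F\,\overline{\partial_{\mathbf x}^\alpha}$ with $\overline{\partial_{\mathbf x}^\alpha}=1\otimes\partial_{x_1}^{\alpha_1}\cdots\partial_{x_n}^{\alpha_n}$. $\Psi:\mathbb F[z_1,\ldots,z_n]^r\to\mathbb F\otimes_R(D_n)^r$ is the $\mathbb F$-linear isomorphism given on each coordinate by $\mathbf z^\alpha\mapsto\overline{\partial_{\mathbf x}^\alpha}$. $\mathbb F[z_1,\ldots,z_n]$ is a module over $\mathbb F[[y_1,\ldots,y_n]]$ with $y_i$ acting as $\partial/\partial z_i$, and for $v\in\mathbb F[[y_1,\ldots,y_n]]^r$, $A\in\mathbb F[z_1,\ldots,z_n]^r$ we put $v\cdot A=\sum_{j=1}^rv_j\cdot A_j$, with $v_j,A_j$ here denoting the $j$-th coordinates of $v$ and $A$. $\Gamma:R^r\hookrightarrow\mathbb F[[y_1,\ldots,y_n]]^r$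 applies in each coordinate the $\Bbbk$-algebra map $\eta':R\hookrightarrow\mathbb F[[y_1,\ldots,y_n]]$, $x_i\mapsto y_i+\overline{x_i}$ for $1\le i\le n$, where $\overline{x_i}$ is the class of $x_i$ in $\mathbb F$.
   Formalization: That the output is 𝔭-primary is asserted only when some A_i is nonzero; if all A_i vanish (e.g. δ_1 = 0, m = 1) the output is R^r, and Ass(R^r/R^r) is empty, so the claim fails there. *)

theory Defs
  imports "HOL-Analysis.Finite_Cartesian_Product" "HOL-Library.Poly_Mapping"
begin

section \<open>Polynomial rings\<close>

text \<open>
  A finite type \<open>'n\<close> indexes the variables, and a finite type \<open>'r\<close> indexes the coordinates of
  \<open>R\<^sup>r\<close>; exponent vectors are of type \<open>'n \<Rightarrow>\<^sub>0 nat\<close>.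
\<close>

type_synonym ('n, 'a) mpoly = "('n \<Rightarrow>\<^sub>0 nat) \<Rightarrow>\<^sub>0 'a"

definition const :: "'a \<Rightarrow> ('n, 'a::zero) mpoly" where
  "const c = Poly_Mapping.single 0 c"

definition var :: "'n \<Rightarrow> ('n, 'a::zero_neq_one) mpoly" where
  "var i = Poly_Mapping.single (Poly_Mapping.single i 1) 1"

definition pdiff :: "'n \<Rightarrow> ('n, 'a::comm_ring_1) mpoly \<Rightarrow> ('n, 'a) mpoly" where
  "pdiff i f = (\<Sum>\<alpha>\<in>Poly_Mapping.keys f. Poly_Mapping.single (\<alpha> - Poly_Mapping.single i 1)
      (of_nat (Poly_Mapping.lookup \<alpha> i) * Poly_Mapping.lookup f \<alpha>))"

text \<open>The order in which the partial derivatives are composed is irrelevant, see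
  \<open>comp_fun_commute_pdiff\<close> below.\<close>

definition mdiff :: "('n::finite \<Rightarrow>\<^sub>0 nat) \<Rightarrow> ('n, 'a::comm_ring_1) mpoly \<Rightarrow> ('n, 'a) mpoly" where
  "mdiff \<alpha> f = Finite_Set.fold (\<lambda>i. pdiff i ^^ Poly_Mapping.lookup \<alpha> i) f UNIV"

lemma lookup_pdiff:
  "Poly_Mapping.lookup (pdiff i f) \<alpha> =
     of_nat (Suc (Poly_Mapping.lookup \<alpha> i)) * Poly_Mapping.lookup f (\<alpha> + Poly_Mapping.single i 1)"
proof -
  let ?e = "Poly_Mapping.single i (1::nat)"
  have eq: "(of_nat (Poly_Mapping.lookup \<beta> i) * Poly_Mapping.lookup f \<beta> when \<beta> - ?e = \<alpha>) =
      (of_nat (Poly_Mapping.lookup \<beta> i) * Poly_Mapping.lookup f \<beta> when \<beta> = \<alpha> + ?e)" for \<beta>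
  proof (cases "Poly_Mapping.lookup \<beta> i = 0")
    case False
    then have "\<beta> - ?e + ?e = \<beta>"
      by (intro poly_mapping_eqI) (auto simp: lookup_add lookup_minus lookup_single when_def)
    then have "\<beta> - ?e = \<alpha> \<longleftrightarrow> \<beta> = \<alpha> + ?e" by auto
    then show ?thesis by simp
  qed (simp add: when_def)
  have "Poly_Mapping.lookup (pdiff i f) \<alpha> = (\<Sum>\<beta>\<in>Poly_Mapping.keys f.
      of_nat (Poly_Mapping.lookup \<beta> i) * Poly_Mapping.lookup f \<beta> when \<beta> = \<alpha> + ?e)"
    unfolding pdiff_def lookup_sum lookup_single eq ..
  also have "\<dots> = of_nat (Suc (Poly_Mapping.lookup \<alpha> i)) * Poly_Mapping.lookup f (\<alpha> + ?e)"
    by (auto simp: when_def sum.delta lookup_add in_keys_iff)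
  finally show ?thesis .
qed

lemma pdiff_commute: "pdiff i (pdiff j f) = pdiff j (pdiff i f)"
proof (rule poly_mapping_eqI)
  fix \<alpha>
  show "Poly_Mapping.lookup (pdiff i (pdiff j f)) \<alpha> = Poly_Mapping.lookup (pdiff j (pdiff i f)) \<alpha>"
    by (cases "i = j") (simp_all add: lookup_pdiff lookup_add lookup_single when_def ac_simps)
qed

lemma comp_fun_commute_pdiff:
  "comp_fun_commute (\<lambda>i. (pdiff i ^^ Poly_Mapping.lookup \<alpha> i) ::
     ('n, 'a::comm_ring_1) mpoly \<Rightarrow> ('n, 'a) mpoly)"
proof
  fix i j :: 'n
  have 1: "(pdiff i ^^ m) (pdiff j f) = pdiff j ((pdiff i ^^ m) f)"
    for m and f :: "('n, 'a) mpoly"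
    by (induction m arbitrary: f) (simp_all add: pdiff_commute[of i j])
  have "(pdiff j ^^ n) ((pdiff i ^^ m) f) = (pdiff i ^^ m) ((pdiff j ^^ n) f)"
    for m n and f :: "('n, 'a) mpoly"
    by (induction n arbitrary: f) (simp_all add: 1)
  then show "((pdiff j ^^ Poly_Mapping.lookup \<alpha> j) :: ('n, 'a) mpoly \<Rightarrow> _) \<circ>
        (pdiff i ^^ Poly_Mapping.lookup \<alpha> i)
      = (pdiff i ^^ Poly_Mapping.lookup \<alpha> i) \<circ> (pdiff j ^^ Poly_Mapping.lookup \<alpha> j)"
    by (intro ext) (simp only: o_apply)
qed

section \<open>Multivariate formal power series\<close>

typedef (overloaded) ('n, 'a) mfps = "UNIV :: (('n \<Rightarrow>\<^sub>0 nat) \<Rightarrow> 'a) set"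
  morphisms mfps_nth Abs_mfps ..

setup_lifting type_definition_mfps

lemma mfps_eqI: "(\<And>\<alpha>. mfps_nth f \<alpha> = mfps_nth g \<alpha>) \<Longrightarrow> f = g"
  by transfer auto

lemma finite_exponent_splits: "finite {(\<beta>, \<gamma>). \<beta> + \<gamma> = (\<alpha> :: 'n::finite \<Rightarrow>\<^sub>0 nat)}"
proof -
  let ?B = "{\<beta>. \<forall>i. Poly_Mapping.lookup \<beta> i \<le> Poly_Mapping.lookup \<alpha> i}"
  have "Poly_Mapping.lookup ` ?B \<subseteq> (\<Pi>\<^sub>E i\<in>UNIV. {..Poly_Mapping.lookup \<alpha> i})"
    by auto
  then have "finite (Poly_Mapping.lookup ` ?B)"
    by (rule finite_subset) (auto intro: finite_PiE)
  then have "finite ?B"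
    by (rule finite_imageD) (auto intro: inj_onI)
  moreover have "{(\<beta>, \<gamma>). \<beta> + \<gamma> = \<alpha>} \<subseteq> ?B \<times> ?B"
    by (auto simp: lookup_add)
  ultimately show ?thesis by (meson finite_SigmaI finite_subset)
qed

instantiation mfps :: (finite, comm_ring_1) comm_ring_1
begin

lift_definition zero_mfps :: "('a, 'b) mfps" is "\<lambda>_. 0" .
lift_definition one_mfps :: "('a, 'b) mfps" is "\<lambda>\<alpha>. if \<alpha> = 0 then 1 else 0" .
lift_definition plus_mfps :: "('a, 'b) mfps \<Rightarrow> ('a, 'b) mfps \<Rightarrow> ('a, 'b) mfps"
  is "\<lambda>f g \<alpha>. f \<alpha> + g \<alpha>" .
lift_definition minus_mfps :: "('a, 'b) mfps \<Rightarrow> ('a, 'b) mfps \<Rightarrow> ('a, 'b) mfps"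
  is "\<lambda>f g \<alpha>. f \<alpha> - g \<alpha>" .
lift_definition uminus_mfps :: "('a, 'b) mfps \<Rightarrow> ('a, 'b) mfps"
  is "\<lambda>f \<alpha>. - f \<alpha>" .
lift_definition times_mfps :: "('a, 'b) mfps \<Rightarrow> ('a, 'b) mfps \<Rightarrow> ('a, 'b) mfps"
  is "\<lambda>f g \<alpha>. \<Sum>(\<beta>, \<gamma>) | \<beta> + \<gamma> = \<alpha>. f \<beta> * g \<gamma>" .

instance
proof
  fix f g h :: "('a, 'b) mfps"
  note fin = finite_exponent_splits
  show "f * g * h = f * (g * h)"
  proof (rule mfps_eqI)
    fix \<alpha>
    let ?F = "mfps_nth f" and ?G = "mfps_nth g" and ?H = "mfps_nth h"
    have "mfps_nth (f * g * h) \<alpha> =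
        (\<Sum>p | fst p + snd p = \<alpha>. \<Sum>q | fst q + snd q = fst p. ?F (fst q) * ?G (snd q) * ?H (snd p))"
      by (simp add: times_mfps.rep_eq case_prod_unfold sum_distrib_right)
    also have "\<dots> = (\<Sum>(p, q)\<in>(SIGMA p:{p. fst p + snd p = \<alpha>}. {q. fst q + snd q = fst p}).
        ?F (fst q) * ?G (snd q) * ?H (snd p))"
      using fin by (intro sum.Sigma) (auto simp: case_prod_unfold)
    also have "\<dots> = (\<Sum>(p, q)\<in>(SIGMA p:{p. fst p + snd p = \<alpha>}. {q. fst q + snd q = snd p}).
        ?F (fst p) * (?G (fst q) * ?H (snd q)))"
      by (rule sum.reindex_bij_witness
          [where j = "\<lambda>(p, q). ((fst q, snd q + snd p), (snd q, snd p))"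
             and i = "\<lambda>(p, q). ((fst p + fst q, snd q), (fst p, fst q))"])
        (auto simp: ac_simps)
    also have "\<dots> = (\<Sum>p | fst p + snd p = \<alpha>. \<Sum>q | fst q + snd q = snd p.
        ?F (fst p) * (?G (fst q) * ?H (snd q)))"
      using fin by (intro sum.Sigma[symmetric]) (auto simp: case_prod_unfold)
    also have "\<dots> = mfps_nth (f * (g * h)) \<alpha>"
      by (simp add: times_mfps.rep_eq case_prod_unfold sum_distrib_left)
    finally show "mfps_nth (f * g * h) \<alpha> = mfps_nth (f * (g * h)) \<alpha>" .
  qed
  show "f * g = g * f"
    by transfer (auto intro!: ext sum.reindex_bij_witness[of _ prod.swap prod.swap] simp: ac_simps)
  show "1 * f = f"
  proof (rule mfps_eqI)
    fix \<alpha>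
    have "mfps_nth (1 * f) \<alpha> = (\<Sum>p\<in>{(0, \<alpha>)}. mfps_nth 1 (fst p) * mfps_nth f (snd p))"
      unfolding times_mfps.rep_eq case_prod_unfold
      by (rule sum.mono_neutral_right)
        (use fin[of \<alpha>] in \<open>auto simp: one_mfps.rep_eq case_prod_unfold\<close>)
    then show "mfps_nth (1 * f) \<alpha> = mfps_nth f \<alpha>" by (simp add: one_mfps.rep_eq)
  qed
  show "(f + g) * h = f * h + g * h"
    by transfer (simp add: case_prod_unfold distrib_right sum.distrib)
  show "(0 :: ('a, 'b) mfps) \<noteq> 1"
    by transfer (metis zero_neq_one)
qed (transfer; simp add: fun_eq_iff ac_simps)+

end

definition mfps_const :: "'a \<Rightarrow> ('n, 'a::zero) mfps" where
  "mfps_const c = Abs_mfps (\<lambda>\<alpha>. if \<alpha> = 0 then c else 0)"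

definition mfps_var :: "'n \<Rightarrow> ('n, 'a::zero_neq_one) mfps" where
  "mfps_var i = Abs_mfps (\<lambda>\<alpha>. if \<alpha> = Poly_Mapping.single i 1 then 1 else 0)"

text \<open>
  The action of \<open>\<bbbF>[[y]]\<close> on \<open>\<bbbF>[z]\<close> in which \<open>y\<^sub>i\<close> acts as \<open>\<partial>/\<partial>z\<^sub>i\<close>. Only finitely many of the
  derivatives of a polynomial are nonzero, so the sum over all exponents has finite support.
\<close>

definition mfps_act :: "('n::finite, 'a::comm_ring_1) mfps \<Rightarrow> ('n, 'a) mpoly \<Rightarrow> ('n, 'a) mpoly" where
  "mfps_act v A = Sum_any (\<lambda>\<beta>. const (mfps_nth v \<beta>) * mdiff \<beta> A)"

definition mfps_act_vec ::
    "('n::finite, 'a::comm_ring_1) mfps ^ 'r::finite \<Rightarrow> ('n, 'a) mpoly ^ 'r \<Rightarrow> ('n, 'a) mpoly" where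
  "mfps_act_vec v A = (\<Sum>j\<in>UNIV. mfps_act (v $ j) (A $ j))"

definition inverse_system ::
    "(('n::finite, 'a::comm_ring_1) mpoly ^ 'r::finite) set \<Rightarrow> (('n, 'a) mfps ^ 'r) set" where
  "inverse_system S = {v. \<forall>A\<in>S. mfps_act_vec v A = 0}"

section \<open>Primes, primary submodules and residue fields\<close>

definition prime_ideal :: "'a::comm_ring_1 set \<Rightarrow> bool" where
  "prime_ideal P \<longleftrightarrow> module.subspace (*) P \<and> 1 \<notin> P \<and> (\<forall>a b. a * b \<in> P \<longrightarrow> a \<in> P \<or> b \<in> P)"

text \<open>The associated primes of \<open>R\<^sup>r/N\<close>; the annihilator of the class of \<open>u\<close> is \<open>{a. a u \<in> N}\<close>.\<close>

definition ass_quot :: "('a::comm_ring_1 ^ 'r::finite) set \<Rightarrow> 'a set set" where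
  "ass_quot N = {Q. prime_ideal Q \<and> (\<exists>u. Q = {a. a *s u \<in> N})}"

definition primary_submodule :: "'a::comm_ring_1 set \<Rightarrow> ('a ^ 'r::finite) set \<Rightarrow> bool" where
  "primary_submodule P N \<longleftrightarrow> module.subspace (*s) N \<and> ass_quot N = {P}"

definition is_ring_hom :: "('a::comm_ring_1 \<Rightarrow> 'b::comm_ring_1) \<Rightarrow> bool" where
  "is_ring_hom \<phi> \<longleftrightarrow> \<phi> 1 = 1 \<and> (\<forall>a b. \<phi> (a + b) = \<phi> a + \<phi> b) \<and> (\<forall>a b. \<phi> (a * b) = \<phi> a * \<phi> b)"

text \<open>
  \<open>R\<^sub>P\<close> depends on the prime \<open>P\<close> and so cannot be a type constructor. Instead, \<open>loc\<close> presents an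
  arbitrary ring type as \<open>R\<^sub>P\<close> (every element is a fraction \<open>a/s\<close> with \<open>s \<notin> P\<close>, and \<open>a/1 = 0\<close> only
  if \<open>s a = 0\<close> for some \<open>s \<notin> P\<close>), and \<open>res\<close> presents an arbitrary field type as \<open>R\<^sub>P/P R\<^sub>P\<close>.
\<close>

definition is_localization_at ::
    "'a::comm_ring_1 set \<Rightarrow> ('a \<Rightarrow> 'l::comm_ring_1) \<Rightarrow> bool" where
  "is_localization_at P loc \<longleftrightarrow> is_ring_hom loc
     \<and> (\<forall>s. s \<notin> P \<longrightarrow> loc s dvd 1)
     \<and> (\<forall>x. \<exists>a s. s \<notin> P \<and> x * loc s = loc a)
     \<and> (\<forall>a. loc a = 0 \<longrightarrow> (\<exists>s. s \<notin> P \<and> s * a = 0))"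

definition is_residue_field ::
    "'a::comm_ring_1 set \<Rightarrow> ('a \<Rightarrow> 'l::comm_ring_1) \<Rightarrow> ('l \<Rightarrow> 'f::field) \<Rightarrow> bool" where
  "is_residue_field P loc res \<longleftrightarrow> is_localization_at P loc \<and> is_ring_hom res \<and> surj res
     \<and> {x. res x = 0} = module.span (*) (loc ` P)"

section \<open>The Weyl algebra\<close>

text \<open>
  In characteristic zero the Weyl algebra is the subring of \<open>End\<^sub>k(R)\<close> generated by the
  multiplication operators and the partial derivatives.
\<close>

inductive_set weyl_algebra ::
    "(('n, 'k::field_char_0) mpoly \<Rightarrow> ('n, 'k) mpoly) set" where
  mult: "(\<lambda>w. f * w) \<in> weyl_algebra"
| pdiff: "pdiff i \<in> weyl_algebra"
| add: "D \<in> weyl_algebra \<Longrightarrow> E \<in> weyl_algebra \<Longrightarrow> (\<lambda>w. D w + E w) \<in> weyl_algebra"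
| comp: "D \<in> weyl_algebra \<Longrightarrow> E \<in> weyl_algebra \<Longrightarrow> (\<lambda>w. D (E w)) \<in> weyl_algebra"

type_synonym ('n, 'k, 'r) dop = "(('n, 'k) mpoly \<Rightarrow> ('n, 'k) mpoly) ^ 'r"

definition weyl_vecs :: "('n, 'k::field_char_0, 'r::finite) dop set" where
  "weyl_vecs = {\<delta>. \<forall>j. \<delta> $ j \<in> weyl_algebra}"

definition dop_apply ::
    "('n, 'k::field_char_0, 'r::finite) dop \<Rightarrow> ('n, 'k) mpoly ^ 'r \<Rightarrow> ('n, 'k) mpoly" where
  "dop_apply \<delta> w = (\<Sum>j\<in>UNIV. (\<delta> $ j) (w $ j))"

definition dop_zero :: "('n, 'k::field_char_0, 'r::finite) dop" where
  "dop_zero = (\<chi> j. (\<lambda>w. 0))"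

definition dop_add ::
    "('n, 'k::field_char_0, 'r::finite) dop \<Rightarrow> ('n, 'k, 'r) dop \<Rightarrow> ('n, 'k, 'r) dop" where
  "dop_add \<delta> \<epsilon> = (\<chi> j. (\<lambda>w. (\<delta> $ j) w + (\<epsilon> $ j) w))"

definition dop_lmult ::
    "('n, 'k::field_char_0) mpoly \<Rightarrow> ('n, 'k, 'r::finite) dop \<Rightarrow> ('n, 'k, 'r) dop" where
  "dop_lmult f \<delta> = (\<chi> j. (\<lambda>w. f * (\<delta> $ j) w))"

definition dop_rmult ::
    "('n, 'k::field_char_0, 'r::finite) dop \<Rightarrow> ('n, 'k) mpoly \<Rightarrow> ('n, 'k, 'r) dop" where
  "dop_rmult \<delta> f = (\<chi> j. (\<lambda>w. (\<delta> $ j) (f * w)))"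

inductive_set bimodule_gen ::
    "('n, 'k::field_char_0, 'r::finite) dop set \<Rightarrow> ('n, 'k, 'r) dop set"
  for S where
  gen: "\<delta> \<in> S \<Longrightarrow> \<delta> \<in> bimodule_gen S"
| zero: "dop_zero \<in> bimodule_gen S"
| add: "\<delta> \<in> bimodule_gen S \<Longrightarrow> \<epsilon> \<in> bimodule_gen S \<Longrightarrow> dop_add \<delta> \<epsilon> \<in> bimodule_gen S"
| lmult: "\<delta> \<in> bimodule_gen S \<Longrightarrow> dop_lmult f \<delta> \<in> bimodule_gen S"
| rmult: "\<delta> \<in> bimodule_gen S \<Longrightarrow> dop_rmult \<delta> f \<in> bimodule_gen S"

section \<open>The tensor product and the maps of the algorithm\<close>

text \<open>
  Throughout, \<open>\<iota> : R \<rightarrow> \<bbbF>\<close> is the canonical map. \<open>\<bbbF> \<otimes>\<^sub>R (D\<^sub>n)\<^sup>r\<close> is the free abelian group on pairs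
  \<open>(a, \<delta>)\<close> modulo the subgroup \<open>tensor_rel \<iota>\<close>, and \<open>tensor_class \<iota> x\<close> is the coset of \<open>x\<close>; here
  \<open>(D\<^sub>n)\<^sup>r\<close> is a left \<open>R\<close>-module by left multiplication.
\<close>

inductive_set tensor_rel ::
    "(('n, 'k::field_char_0) mpoly \<Rightarrow> 'f::field) \<Rightarrow> (('f \<times> ('n, 'k, 'r::finite) dop) \<Rightarrow>\<^sub>0 int) set"
  for \<iota> where
  zero: "0 \<in> tensor_rel \<iota>"
| diff: "x \<in> tensor_rel \<iota> \<Longrightarrow> y \<in> tensor_rel \<iota> \<Longrightarrow> x - y \<in> tensor_rel \<iota>"
| add_left: "\<delta> \<in> weyl_vecs \<Longrightarrow>
    frag_of (a + b, \<delta>) - frag_of (a, \<delta>) - frag_of (b, \<delta>) \<in> tensor_rel \<iota>"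
| add_right: "\<delta> \<in> weyl_vecs \<Longrightarrow> \<epsilon> \<in> weyl_vecs \<Longrightarrow>
    frag_of (a, dop_add \<delta> \<epsilon>) - frag_of (a, \<delta>) - frag_of (a, \<epsilon>) \<in> tensor_rel \<iota>"
| balanced: "\<delta> \<in> weyl_vecs \<Longrightarrow>
    frag_of (a * \<iota> f, \<delta>) - frag_of (a, dop_lmult f \<delta>) \<in> tensor_rel \<iota>"

definition tensor_class ::
    "(('n, 'k::field_char_0) mpoly \<Rightarrow> 'f::field) \<Rightarrow> (('f \<times> ('n, 'k, 'r::finite) dop) \<Rightarrow>\<^sub>0 int) \<Rightarrow>
      (('f \<times> ('n, 'k, 'r) dop) \<Rightarrow>\<^sub>0 int) set" where
  "tensor_class \<iota> x = {y. y - x \<in> tensor_rel \<iota>}"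

definition Phi ::
    "(('n, 'k::field_char_0) mpoly \<Rightarrow> 'f::field) \<Rightarrow> ('n, 'k, 'r::finite) dop \<Rightarrow>
      (('f \<times> ('n, 'k, 'r) dop) \<Rightarrow>\<^sub>0 int) set" where
  "Phi \<iota> \<delta> = tensor_class \<iota> (frag_of (1, \<delta>))"

definition dop_axis ::
    "'r \<Rightarrow> (('n, 'k::field_char_0) mpoly \<Rightarrow> ('n, 'k) mpoly) \<Rightarrow> ('n, 'k, 'r::finite) dop" where
  "dop_axis j D = (\<chi> i. if i = j then D else (\<lambda>w. 0))"

text \<open>\<open>c z\<^sup>\<alpha> e\<^sub>j \<mapsto> c (1 \<otimes> \<partial>\<^sup>\<alpha> e\<^sub>j) = c \<otimes> \<partial>\<^sup>\<alpha> e\<^sub>j\<close>.\<close>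

definition Psi ::
    "(('n::finite, 'k::field_char_0) mpoly \<Rightarrow> 'f::field) \<Rightarrow> ('n, 'f) mpoly ^ 'r::finite \<Rightarrow>
      (('f \<times> ('n, 'k, 'r) dop) \<Rightarrow>\<^sub>0 int) set" where
  "Psi \<iota> A = tensor_class \<iota> (\<Sum>j\<in>UNIV. \<Sum>\<alpha>\<in>Poly_Mapping.keys (A $ j).
     frag_of (Poly_Mapping.lookup (A $ j) \<alpha>, dop_axis j (mdiff \<alpha>)))"

definition eta ::
    "(('n::finite, 'k::field_char_0) mpoly \<Rightarrow> 'f::field) \<Rightarrow> ('n, 'k) mpoly \<Rightarrow> ('n, 'f) mfps" where
  "eta \<iota> f = (\<Sum>\<alpha>\<in>Poly_Mapping.keys f. mfps_const (\<iota> (const (Poly_Mapping.lookup f \<alpha>))) *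
     (\<Prod>i\<in>UNIV. (mfps_var i + mfps_const (\<iota> (var i))) ^ Poly_Mapping.lookup \<alpha> i))"

definition Gam ::
    "(('n::finite, 'k::field_char_0) mpoly \<Rightarrow> 'f::field) \<Rightarrow> ('n, 'k) mpoly ^ 'r::finite \<Rightarrow>
      ('n, 'f) mfps ^ 'r" where
  "Gam \<iota> w = (\<chi> j. eta \<iota> (w $ j))"

end

theory Submission
  imports Defs
begin

text \<open>
  Let \<open>\<iota> : R \<rightarrow> \<bbbF>\<close> be the canonical map. A polynomial \<open>P = \<Sum> P\<^sub>\<beta> z\<^sup>\<beta>\<close> over \<open>\<bbbF>\<close> stands for the
  operator \<open>\<Sum> P\<^sub>\<beta> \<partial>\<^sup>\<beta>\<close> whose values are reduced modulo \<open>\<pp>\<close>; this gives the pairing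
  \<open>pairing \<iota> g P = \<Sum> P\<^sub>\<beta> \<iota> (\<partial>\<^sup>\<beta> g)\<close> of \<open>R\<close> with \<open>\<bbbF>[z]\<close>. The whole argument takes place inside this
  pairing, and rests on two properties.

  First, a polynomial \<open>P\<close> is determined by its pairings (\<open>pairing_nondegenerate\<close>). Multiplying \<open>g\<close> by
  \<open>x\<^sub>i\<close> replaces \<open>P\<close> by \<open>\<iota>(x\<^sub>i) P + \<partial>P/\<partial>z\<^sub>i\<close>, so if all pairings with \<open>P\<close> vanish, the same holds for the
  derivatives of \<open>P\<close>, and one concludes by induction on the degree, in characteristic zero.

  Second, multiplication by \<open>f\<close> on \<open>R\<close> is adjoint to the action of the power series \<open>eta \<iota> f\<close> on \<open>\<bbbF>[z]\<close>
  (\<open>pairing_mult\<close>). By the rule just quoted, \<open>x\<^sub>i\<close> is adjoint to \<open>y\<^sub>i + \<iota>(x\<^sub>i)\<close>, which is exactly where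
  \<open>eta\<close> sends \<open>x\<^sub>i\<close>.

  The polynomial vector \<open>A\<close> with \<open>Psi A = Phi \<delta>\<close> satisfies \<open>pairing \<iota> g A\<^sub>j = \<iota> (\<delta>\<^sub>j g)\<close>
  (\<open>pairing_inv_Psi\<close>): existence of \<open>A\<close> comes from writing elements of the Weyl algebra with
  the coefficients on the left of the derivatives, and the formula from the functionals
  \<open>a \<otimes> \<delta> \<mapsto> a \<iota> (\<delta>\<^sub>j g)\<close> on the tensor product. By adjointness the pairing of \<open>g\<close> with \<open>Gam(w) \<cdot> A\<close> is
  \<open>\<iota> (\<delta> (g w))\<close>. Hence \<open>Gam(w) \<cdot> A = 0\<close> if and only if \<open>\<delta> (g w) \<in> \<pp>\<close> for all \<open>g\<close>, and this is the
  condition that the bimodule generated by \<open>\<delta>\<close> sends \<open>w\<close> into \<open>\<pp>\<close>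
  (\<open>bimodule_gen_apply_in_ideal_iff\<close>).

  Finally, \<open>eta \<iota> f\<close> has constant term \<open>\<iota> f\<close>. For \<open>f \<notin> \<pp>\<close> it preserves the top degree part of a
  polynomial up to a nonzero scalar, so \<open>f\<close> acts injectively modulo the submodule; for \<open>f \<in> \<pp>\<close> it lowers
  degrees, so \<open>f\<close> acts locally nilpotently. A nonzero class on which the degree is as small as possible is
  annihilated by all of \<open>\<pp>\<close>, and \<open>\<pp>\<close> is the only associated prime (\<open>primary_submodule_Gam_vimage\<close>).
\<close>

(* Unit exponent vectors are to stay in the form \<open>single i 1\<close>. *)
declare One_nat_def [simp del]

section \<open>Exponent vectors and polynomials\<close>

abbreviation lookup :: "('a \<Rightarrow>\<^sub>0 'b::zero) \<Rightarrow> 'a \<Rightarrow> 'b" where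
  "lookup \<equiv> Poly_Mapping.lookup"

abbreviation keys :: "('a \<Rightarrow>\<^sub>0 'b::zero) \<Rightarrow> 'a set" where
  "keys \<equiv> Poly_Mapping.keys"

abbreviation single :: "'a \<Rightarrow> 'b \<Rightarrow> ('a \<Rightarrow>\<^sub>0 'b::zero)" where
  "single \<equiv> Poly_Mapping.single"

abbreviation unit :: "'n \<Rightarrow> ('n \<Rightarrow>\<^sub>0 nat)" where
  "unit i \<equiv> Poly_Mapping.single i 1"

definition total_degree :: "('n::finite \<Rightarrow>\<^sub>0 nat) \<Rightarrow> nat" where
  "total_degree \<alpha> = (\<Sum>i\<in>UNIV. lookup \<alpha> i)"

lemma total_degree_add: "total_degree (\<alpha> + \<beta>) = total_degree \<alpha> + total_degree \<beta>"
  by (simp add: total_degree_def lookup_add sum.distrib)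

lemma total_degree_eq_0_iff: "total_degree \<alpha> = 0 \<longleftrightarrow> \<alpha> = 0"
  by (auto simp: total_degree_def intro!: poly_mapping_eqI)

lemma total_degree_unit [simp]: "total_degree (unit i) = 1"
  by (simp add: total_degree_def lookup_single when_def)

lemma minus_unit_add_unit: "lookup \<alpha> i \<noteq> 0 \<Longrightarrow> \<alpha> - unit i + unit i = (\<alpha> :: 'n \<Rightarrow>\<^sub>0 nat)"
  by (intro poly_mapping_eqI) (auto simp: lookup_add lookup_minus lookup_single when_def)

lemma nonzero_exponentE:
  assumes "\<alpha> \<noteq> (0 :: 'n \<Rightarrow>\<^sub>0 nat)"
  obtains i \<beta> where "\<alpha> = \<beta> + unit i"
proof -
  obtain i where "lookup \<alpha> i \<noteq> 0"
    using assms by (metis lookup_zero poly_mapping_eqI)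
  then show thesis using minus_unit_add_unit[of \<alpha> i] that by metis
qed

lemma exponent_induct [case_names zero add_unit]:
  fixes \<alpha> :: "'n::finite \<Rightarrow>\<^sub>0 nat"
  assumes "P 0" and "\<And>\<alpha> i. P \<alpha> \<Longrightarrow> P (\<alpha> + unit i)"
  shows "P \<alpha>"
proof (induction "total_degree \<alpha>" arbitrary: \<alpha>)
  case 0
  then show ?case using assms(1) by (simp add: total_degree_eq_0_iff)
next
  case (Suc d)
  then have "\<alpha> \<noteq> 0" by (metis total_degree_eq_0_iff nat.distinct(1))
  then obtain i \<beta> where "\<alpha> = \<beta> + unit i" by (rule nonzero_exponentE)
  with Suc assms(2) show ?case by (simp add: total_degree_add)
qed

lemma mpoly_monomial_sum: "(\<Sum>\<alpha>\<in>keys f. single \<alpha> (lookup f \<alpha>)) = f"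
  by (intro poly_mapping_eqI)
    (auto simp: lookup_sum lookup_single when_def sum.delta in_keys_iff)

lemma mpoly_induct [case_names monomial add]:
  fixes f :: "('n, 'a::comm_ring_1) mpoly"
  assumes "\<And>\<alpha> c. P (single \<alpha> c)" and "\<And>f g. P f \<Longrightarrow> P g \<Longrightarrow> P (f + g)"
  shows "P f"
proof -
  have "P (\<Sum>\<alpha>\<in>B. single \<alpha> (lookup f \<alpha>))" if "finite B" for B
    using that
  proof (induction B)
    case empty
    then show ?case using assms(1)[of 0 0] by simp
  qed (simp add: assms)
  from this[of "keys f"] show ?thesis by (simp add: mpoly_monomial_sum)
qed

lemma lookup_const_mult [simp]: "lookup (const c * f) \<alpha> = c * lookup f \<alpha>"
  for f :: "('n, 'a::comm_ring_1) mpoly"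
  by (induction f rule: mpoly_induct)
    (simp_all add: const_def mult_single lookup_single when_def distrib_left lookup_add)

lemma const_add: "const (a + b) = const a + const b"
  by (simp add: const_def single_add)

lemma const_1 [simp]: "const 1 = 1"
  by (simp add: const_def)

lemma const_0 [simp]: "const 0 = 0"
  by (simp add: const_def)

section \<open>Partial derivatives\<close>

lemma pdiff_add: "pdiff i (f + g) = pdiff i f + pdiff i g"
  by (intro poly_mapping_eqI) (simp add: lookup_pdiff lookup_add distrib_left)

lemma pdiff_0 [simp]: "pdiff i 0 = 0"
  by (intro poly_mapping_eqI) (simp add: lookup_pdiff)

lemma pdiff_const_mult: "pdiff i (const c * f) = const c * pdiff i f"
  by (intro poly_mapping_eqI) (simp add: lookup_pdiff mult.left_commute)

lemma pdiff_sum: "pdiff i (sum f B) = (\<Sum>x\<in>B. pdiff i (f x))"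
  by (induction B rule: infinite_finite_induct) (simp_all add: pdiff_add)

lemma pdiff_single: "pdiff i (single \<alpha> c) = single (\<alpha> - unit i) (of_nat (lookup \<alpha> i) * c)"
  by (cases "c = 0") (simp_all add: pdiff_def)

lemma pdiff_var: "pdiff i (var j) = (if i = j then 1 else 0)"
  by (simp add: var_def pdiff_single lookup_single when_def single_diff[symmetric])

lemma pdiff_single_mult_single:
  "pdiff i (single \<alpha> c * single \<beta> d) =
     pdiff i (single \<alpha> c) * single \<beta> d + single \<alpha> c * pdiff i (single \<beta> d)"
proof -
  have 1: "single (\<alpha> + \<beta> - unit i) (of_nat (lookup \<alpha> i) * (c * d)) =
      single (\<alpha> - unit i + \<beta>) (of_nat (lookup \<alpha> i) * (c * d))" for \<alpha> \<beta>
  proof (cases "lookup \<alpha> i = 0")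
    case False
    then have "\<alpha> + \<beta> - unit i = \<alpha> - unit i + \<beta>"
      by (intro poly_mapping_eqI) (auto simp: lookup_add lookup_minus lookup_single when_def)
    then show ?thesis by simp
  qed simp
  from 1[of \<alpha> \<beta>] 1[of \<beta> \<alpha>] show ?thesis
    by (simp add: pdiff_single mult_single lookup_add distrib_left distrib_right single_add ac_simps)
qed

lemma pdiff_mult: "pdiff i (f * g) = pdiff i f * g + f * pdiff i g"
proof (induction f rule: mpoly_induct)
  case (monomial \<alpha> c)
  show ?case
    by (induction g rule: mpoly_induct)
      (simp_all add: pdiff_single_mult_single pdiff_add algebra_simps)
qed (simp add: pdiff_add algebra_simps)

lemma mdiff_0 [simp]: "mdiff 0 f = f"
proof -
  have "Finite_Set.fold (\<lambda>i::'a. \<lambda>f. f) f B = f" if "finite B" for B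
  proof -
    interpret comp_fun_commute "\<lambda>i::'a. \<lambda>f::('a, 'b) mpoly. f"
      by standard auto
    from that show ?thesis by (induction B) simp_all
  qed
  then show ?thesis by (simp add: mdiff_def id_def)
qed

lemma mdiff_add_unit: "mdiff (\<alpha> + unit i) f = pdiff i (mdiff \<alpha> f)"
proof -
  let ?F = "\<lambda>\<alpha> j. pdiff j ^^ lookup \<alpha> j :: ('a, 'b) mpoly \<Rightarrow> ('a, 'b) mpoly"
  have *: "mdiff \<beta> f = (pdiff i ^^ lookup \<beta> i) (Finite_Set.fold (?F \<beta>) f (UNIV - {i}))" for \<beta>
  proof -
    interpret comp_fun_commute "?F \<beta>" by (rule comp_fun_commute_pdiff)
    show ?thesis unfolding mdiff_def by (rule fold_rec) simp_all
  qed
  have "Finite_Set.fold (?F (\<alpha> + unit i)) f (UNIV - {i}) = Finite_Set.fold (?F \<alpha>) f (UNIV - {i})"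
  proof (rule fold_closed_eq[where B = UNIV])
  qed (simp_all add: lookup_add lookup_single when_def)
  moreover have "lookup (\<alpha> + unit i) i = Suc (lookup \<alpha> i)"
    by (simp add: lookup_add)
  ultimately show ?thesis
    unfolding *[of "\<alpha> + unit i"] *[of \<alpha>] by simp
qed

lemma mdiff_add: "mdiff \<alpha> (f + g) = mdiff \<alpha> f + mdiff \<alpha> g"
  by (induction \<alpha> rule: exponent_induct) (simp_all add: mdiff_add_unit pdiff_add)

lemma mdiff_const_mult: "mdiff \<alpha> (const c * f) = const c * mdiff \<alpha> f"
  by (induction \<alpha> rule: exponent_induct) (simp_all add: mdiff_add_unit pdiff_const_mult)

lemma mdiff_zero_right [simp]: "mdiff \<alpha> 0 = 0"
  using mdiff_const_mult[of \<alpha> 0 0] by simp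

text \<open>
  The commutation relation of the Weyl algebra: the commutator of \<open>\<partial>\<^sup>\<beta>\<close> and \<open>x\<^sub>i\<close> is
  \<open>\<beta>\<^sub>i \<partial>\<^bsup>\<beta> - e\<^sub>i\<^esup>\<close>. For \<open>\<beta>\<^sub>i = 0\<close> the truncated \<open>\<beta> - unit i\<close> is harmless because of the factor \<open>\<beta>\<^sub>i\<close>.
\<close>

lemma mdiff_var_mult:
  "mdiff \<beta> (var i * g) = var i * mdiff \<beta> g + of_nat (lookup \<beta> i) * mdiff (\<beta> - unit i) g"
proof (induction \<beta> rule: exponent_induct)
  case (add_unit \<beta> j)
  have [simp]: "pdiff j (of_nat n :: ('a, 'b) mpoly) = 0" for n
    by (simp add: pdiff_single flip: single_of_nat)
  have step: "mdiff (\<beta> + unit j) (var i * g) =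
      (if i = j then mdiff \<beta> g else 0) + var i * mdiff (\<beta> + unit j) g
      + of_nat (lookup \<beta> i) * mdiff (\<beta> - unit i + unit j) g"
    by (auto simp: mdiff_add_unit add_unit pdiff_add pdiff_mult pdiff_var)
  show ?case
  proof (cases "i = j")
    case True
    have "of_nat (lookup \<beta> i) * mdiff (\<beta> - unit i + unit i) g = of_nat (lookup \<beta> i) * mdiff \<beta> g"
      by (cases "lookup \<beta> i = 0") (simp_all add: minus_unit_add_unit)
    with True step show ?thesis
      by (simp add: lookup_add algebra_simps)
  next
    case False
    then have "\<beta> + unit j - unit i = \<beta> - unit i + unit j"
      by (intro poly_mapping_eqI) (auto simp: lookup_add lookup_minus lookup_single when_def)
    with False step show ?thesis
      by (simp add: lookup_add lookup_single when_def)
  qed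
qed simp

text \<open>
  Controlling which monomials survive differentiation bounds degrees and makes the action of a
  power series a finite sum; the numerical factors do not matter for either.
\<close>

lemma lookup_mdiff_nonzero:
  "lookup (mdiff \<alpha> f) \<beta> \<noteq> 0 \<Longrightarrow> \<alpha> + \<beta> \<in> keys f"
proof (induction \<alpha> arbitrary: \<beta> rule: exponent_induct)
  case (add_unit \<alpha> i)
  then have "lookup (mdiff \<alpha> f) (\<beta> + unit i) \<noteq> 0"
    by (auto simp: mdiff_add_unit lookup_pdiff)
  from add_unit.IH[OF this] show ?case by (simp add: ac_simps)
qed (simp add: in_keys_iff)

lemma finite_mdiff_support: "finite {\<alpha>. mdiff \<alpha> f \<noteq> 0}"
proof -
  have "{\<alpha>. mdiff \<alpha> f \<noteq> 0} \<subseteq> fst ` (\<Union>\<gamma>\<in>keys f. {(\<alpha>, \<beta>). \<alpha> + \<beta> = \<gamma>})"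
  proof
    fix \<alpha> assume "\<alpha> \<in> {\<alpha>. mdiff \<alpha> f \<noteq> 0}"
    then obtain \<beta> where "lookup (mdiff \<alpha> f) \<beta> \<noteq> 0"
      using poly_mapping_eqI[of "mdiff \<alpha> f" 0] by auto
    then have "\<alpha> + \<beta> \<in> keys f" by (rule lookup_mdiff_nonzero)
    then show "\<alpha> \<in> fst ` (\<Union>\<gamma>\<in>keys f. {(\<alpha>, \<beta>). \<alpha> + \<beta> = \<gamma>})"
      by (intro image_eqI[of _ _ "(\<alpha>, \<beta>)"]) simp_all
  qed
  then show ?thesis by (rule finite_subset) (simp add: finite_exponent_splits)
qed

section \<open>The action of power series on polynomials\<close>

lemma mfps_act_eq_sum:
  assumes "finite B" and "\<And>\<beta>. mdiff \<beta> A \<noteq> 0 \<Longrightarrow> \<beta> \<in> B"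
  shows "mfps_act v A = (\<Sum>\<beta>\<in>B. const (mfps_nth v \<beta>) * mdiff \<beta> A)"
  unfolding mfps_act_def
  by (rule Sum_any.expand_superset[OF assms(1)])
    (metis (mono_tags, lifting) assms(2) mem_Collect_eq mult_zero_right subsetI)

lemma lookup_mfps_act:
  "lookup (mfps_act v A) \<beta> = (\<Sum>\<alpha> | mdiff \<alpha> A \<noteq> 0. mfps_nth v \<alpha> * lookup (mdiff \<alpha> A) \<beta>)"
  using finite_mdiff_support[of A]
  by (subst mfps_act_eq_sum[of "{\<alpha>. mdiff \<alpha> A \<noteq> 0}"]) (simp_all add: lookup_sum)

lemma mfps_act_add: "mfps_act (u + v) A = mfps_act u A + mfps_act v A"
  by (intro poly_mapping_eqI)
    (simp add: lookup_mfps_act plus_mfps.rep_eq distrib_right sum.distrib lookup_add)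

lemma mfps_nth_const [simp]: "mfps_nth (mfps_const c) \<alpha> = (if \<alpha> = 0 then c else 0)"
  by (simp add: mfps_const_def Abs_mfps_inverse)

lemma mfps_nth_var [simp]: "mfps_nth (mfps_var i) \<alpha> = (if \<alpha> = unit i then 1 else 0)"
  by (simp add: mfps_var_def Abs_mfps_inverse)

lemma mfps_nth_const_mult: "mfps_nth (mfps_const c * v) \<alpha> = c * mfps_nth v \<alpha>"
  for v :: "('n::finite, 'a::comm_ring_1) mfps"
proof -
  have "mfps_nth (mfps_const c * v) \<alpha> =
      (\<Sum>p\<in>{(0, \<alpha>)}. mfps_nth (mfps_const c :: ('n, 'a) mfps) (fst p) * mfps_nth v (snd p))"
    unfolding times_mfps.rep_eq case_prod_unfold
    by (rule sum.mono_neutral_right)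
      (use finite_exponent_splits[of \<alpha>] in \<open>auto simp: case_prod_unfold\<close>)
  then show ?thesis by simp
qed

lemma mfps_nth_var_mult_add: "mfps_nth (mfps_var i * v) (\<alpha> + unit i) = mfps_nth v \<alpha>"
proof -
  have "mfps_nth (mfps_var i * v) (\<alpha> + unit i) =
      (\<Sum>p\<in>{(unit i, \<alpha>)}. mfps_nth (mfps_var i) (fst p) * mfps_nth v (snd p))"
    unfolding times_mfps.rep_eq case_prod_unfold
    by (rule sum.mono_neutral_right)
      (use finite_exponent_splits[of "\<alpha> + unit i"] in \<open>auto simp: case_prod_unfold ac_simps\<close>)
  then show ?thesis by simp
qed

lemma mfps_nth_var_mult_0:
  "(\<And>\<beta>. \<alpha> \<noteq> \<beta> + unit i) \<Longrightarrow> mfps_nth (mfps_var i * v) \<alpha> = 0"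
  unfolding times_mfps.rep_eq case_prod_unfold
  by (rule sum.neutral) (auto simp: add.commute)

lemma mfps_act_const_mult: "mfps_act (mfps_const c * v) A = const c * mfps_act v A"
  by (intro poly_mapping_eqI)
    (simp add: lookup_mfps_act mfps_nth_const_mult sum_distrib_left mult.assoc)

lemma mfps_act_1 [simp]: "mfps_act 1 A = A"
proof -
  have "mfps_act 1 A = (\<Sum>\<beta>\<in>{0}. const (mfps_nth 1 \<beta>) * mdiff \<beta> A)"
    unfolding mfps_act_def
    by (rule Sum_any.expand_superset) (auto simp: one_mfps.rep_eq)
  then show ?thesis by (simp add: one_mfps.rep_eq)
qed

text \<open>
  Multiplication by \<open>y\<^sub>i\<close> shifts the coefficients of \<open>v\<close> by \<open>unit i\<close>, and the shift is absorbed by one more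
  derivative on \<open>A\<close>. The series of \<open>y\<^sub>i v\<close> is supported on the exponents divisible by \<open>y\<^sub>i\<close>, so the sum
  may be reindexed from \<open>(\<lambda>\<beta>. \<beta> + unit i) ` C\<close>.
\<close>

lemma mfps_act_var_mult: "mfps_act (mfps_var i * v) A = pdiff i (mfps_act v A)"
proof -
  define C where "C = {\<beta>. mdiff \<beta> A \<noteq> 0}"
  define B where "B = C \<union> (\<lambda>\<beta>. \<beta> + unit i) ` C"
  have fin: "finite C" "finite B"
    using finite_mdiff_support[of A] by (simp_all add: B_def C_def)
  have "mfps_act (mfps_var i * v) A =
      (\<Sum>\<beta>\<in>B. const (mfps_nth (mfps_var i * v) \<beta>) * mdiff \<beta> A)"
    by (rule mfps_act_eq_sum[OF fin(2)]) (simp add: B_def C_def)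
  also have "\<dots> = (\<Sum>\<beta>\<in>(\<lambda>\<beta>. \<beta> + unit i) ` C. const (mfps_nth (mfps_var i * v) \<beta>) * mdiff \<beta> A)"
  proof (rule sum.mono_neutral_right[OF fin(2)])
    show "\<forall>\<beta>\<in>B - (\<lambda>\<beta>. \<beta> + unit i) ` C. const (mfps_nth (mfps_var i * v) \<beta>) * mdiff \<beta> A = 0"
    proof
      fix \<beta> assume \<beta>: "\<beta> \<in> B - (\<lambda>\<beta>. \<beta> + unit i) ` C"
      show "const (mfps_nth (mfps_var i * v) \<beta>) * mdiff \<beta> A = 0"
      proof (cases "\<exists>\<gamma>. \<beta> = \<gamma> + unit i")
        case True
        then obtain \<gamma> where \<gamma>: "\<beta> = \<gamma> + unit i" ..
        with \<beta> have "\<gamma> \<notin> C" by blast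
        with \<gamma> show ?thesis by (simp add: C_def mdiff_add_unit)
      qed (simp add: mfps_nth_var_mult_0)
    qed
  qed (simp add: B_def)
  also have "\<dots> = (\<Sum>\<beta>\<in>C. const (mfps_nth v \<beta>) * pdiff i (mdiff \<beta> A))"
    by (subst sum.reindex) (simp_all add: inj_on_def mfps_nth_var_mult_add mdiff_add_unit)
  also have "\<dots> = pdiff i (mfps_act v A)"
    by (subst mfps_act_eq_sum[OF fin(1)]) (simp_all add: C_def pdiff_sum pdiff_const_mult)
  finally show ?thesis .
qed


section \<open>Substitution of a point into a differential operator\<close>

lemma is_ring_hom_simps:
  assumes "is_ring_hom \<phi>"
  shows "\<phi> 1 = 1" "\<phi> (a + b) = \<phi> a + \<phi> b" "\<phi> (a * b) = \<phi> a * \<phi> b" "\<phi> 0 = 0" "\<phi> (- a) = - \<phi> a"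
    "\<phi> (a - b) = \<phi> a - \<phi> b" "\<phi> (of_nat n) = of_nat n" "\<phi> (sum g B) = (\<Sum>x\<in>B. \<phi> (g x))"
proof -
  show 1: "\<phi> 1 = 1" and 2: "\<phi> (a + b) = \<phi> a + \<phi> b" and "\<phi> (a * b) = \<phi> a * \<phi> b" for a b
    using assms by (simp_all add: is_ring_hom_def)
  show 3: "\<phi> 0 = 0" using 2[of 0 0] by simp
  show 4: "\<phi> (- a) = - \<phi> a" for a
    using 2[of a "- a"] 3 by (simp add: eq_neg_iff_add_eq_0 add.commute)
  show "\<phi> (a - b) = \<phi> a - \<phi> b" using 2[of a "- b"] 4[of b] by simp
  show "\<phi> (of_nat n) = of_nat n" by (induction n) (simp_all add: 1 2 3)
  show "\<phi> (sum g B) = (\<Sum>x\<in>B. \<phi> (g x))"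
    by (induction B rule: infinite_finite_induct) (simp_all add: 2 3)
qed

text \<open>
  The polynomial \<open>P\<close> is the symbol of a differential operator with coefficients in the target of \<open>\<phi>\<close>.
  Taking \<open>\<phi>\<close> to be the identity gives the action of an operator in normal form on \<open>R\<close>, see \<open>has_symbol\<close>;
  the residue field map gives the operator followed by reduction modulo \<open>\<pp>\<close>.
\<close>

definition pairing ::
    "(('n::finite, 'k::comm_ring_1) mpoly \<Rightarrow> 's::comm_ring_1) \<Rightarrow> ('n, 'k) mpoly \<Rightarrow> ('n, 's) mpoly \<Rightarrow> 's"
  where "pairing \<phi> g P = (\<Sum>\<beta>\<in>keys P. \<phi> (mdiff \<beta> g) * lookup P \<beta>)"

lemma pairing_eq_sum:
  "finite B \<Longrightarrow> keys P \<subseteq> B \<Longrightarrow> pairing \<phi> g P = (\<Sum>\<beta>\<in>B. \<phi> (mdiff \<beta> g) * lookup P \<beta>)"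
  unfolding pairing_def by (rule sum.mono_neutral_left) (auto simp: in_keys_iff)

lemma pairing_add_right: "pairing \<phi> g (P + Q) = pairing \<phi> g P + pairing \<phi> g Q"
proof -
  let ?B = "keys P \<union> keys Q \<union> keys (P + Q)"
  show ?thesis
    by (subst (1 2 3) pairing_eq_sum[of ?B])
      (auto simp: lookup_add distrib_left sum.distrib)
qed

lemma pairing_0_right [simp]: "pairing \<phi> g 0 = 0"
  by (simp add: pairing_def)

lemma pairing_sum_right: "pairing \<phi> g (sum P B) = (\<Sum>x\<in>B. pairing \<phi> g (P x))"
  by (induction B rule: infinite_finite_induct) (simp_all add: pairing_add_right)

lemma pairing_single: "pairing \<phi> g (single \<alpha> c) = \<phi> (mdiff \<alpha> g) * c"
  by (subst pairing_eq_sum[of "{\<alpha>}"]) (simp_all add: keys_single)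

lemma pairing_const: "pairing \<phi> g (const c) = \<phi> g * c"
  by (simp add: const_def pairing_single)

lemma pairing_const_mult_right: "pairing \<phi> g (const c * P) = c * pairing \<phi> g P"
  by (subst pairing_eq_sum[of "keys P"])
    (auto simp: in_keys_iff pairing_def sum_distrib_left mult.left_commute)

lemma pairing_diff_right: "pairing \<phi> g (P - Q) = pairing \<phi> g P - pairing \<phi> g Q"
  using pairing_add_right[of \<phi> g "P - Q" Q] by simp

lemma pairing_add_left:
  "is_ring_hom \<phi> \<Longrightarrow> pairing \<phi> (f + g) P = pairing \<phi> f P + pairing \<phi> g P"
  by (simp add: pairing_def mdiff_add is_ring_hom_simps distrib_right sum.distrib)

lemma pairing_const_mult_left:
  "is_ring_hom \<phi> \<Longrightarrow> pairing \<phi> (const c * g) P = \<phi> (const c) * pairing \<phi> g P"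
  by (simp add: pairing_def mdiff_const_mult is_ring_hom_simps sum_distrib_left mult.assoc)

text \<open>
  On symbols, the commutator with \<open>x\<^sub>i\<close> is the derivative with respect to \<open>z\<^sub>i\<close>; this is why \<open>y\<^sub>i\<close> acts as
  \<open>\<partial>/\<partial>z\<^sub>i\<close>.
\<close>

lemma pairing_var_mult:
  assumes "is_ring_hom \<phi>"
  shows "pairing \<phi> (var i * g) P = \<phi> (var i) * pairing \<phi> g P + pairing \<phi> g (pdiff i P)"
  by (induction P rule: mpoly_induct)
    (simp_all add: pairing_single pdiff_single mdiff_var_mult is_ring_hom_simps[OF assms]
      pairing_add_right pdiff_add distrib_left distrib_right mult.assoc mult.left_commute)

text \<open>
  The residue field inherits characteristic zero because positive integers are already units in the
  coefficient field.
\<close>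

lemma of_nat_Suc_neq_0_if_hom:
  assumes "is_ring_hom (\<phi> :: ('n, 'k::field_char_0) mpoly \<Rightarrow> 'f::field)"
  shows "of_nat (Suc n) \<noteq> (0 :: 'f)"
proof
  assume 0: "of_nat (Suc n) = (0 :: 'f)"
  have "(of_nat (Suc n) :: ('n, 'k) mpoly) * const (inverse (of_nat (Suc n))) = 1"
    unfolding single_of_nat[symmetric] const_def mult_single
    by (simp del: of_nat_Suc single_of_nat)
  then have "\<phi> (of_nat (Suc n)) * \<phi> (const (inverse (of_nat (Suc n)))) = 1"
    using is_ring_hom_simps(1,3)[OF assms] by metis
  with 0 show False by (simp add: is_ring_hom_simps(7)[OF assms] del: of_nat_Suc)
qed

text \<open>
  The set of all \<open>P\<close> that pair to zero with everything is closed under the derivatives, by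
  \<open>pairing_var_mult\<close>. By induction on the degree all derivatives of such a \<open>P\<close> vanish, so that \<open>P\<close> is a
  constant in characteristic zero, and the constant is the pairing with \<open>1\<close>.
\<close>

lemma pairing_nondegenerate:
  fixes \<phi> :: "('n::finite, 'k::field_char_0) mpoly \<Rightarrow> 'f::field"
  assumes hom: "is_ring_hom \<phi>" and "\<And>g. pairing \<phi> g P = 0"
  shows "P = 0"
proof -
  have "P = 0" if "\<And>g. pairing \<phi> g P = 0" and "\<And>\<beta>. \<beta> \<in> keys P \<Longrightarrow> total_degree \<beta> < d" for P d
    using that
  proof (induction d arbitrary: P)
    case 0
    then have "keys P = {}" by blast
    then show ?case by simp
  next
    case (Suc d)
    have "pdiff i P = 0" for i
    proof (rule Suc.IH)
      show "pairing \<phi> g (pdiff i P) = 0" for g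
        using pairing_var_mult[OF hom, of i g P] by (simp add: Suc.prems(1))
      show "total_degree \<beta> < d" if "\<beta> \<in> keys (pdiff i P)" for \<beta>
      proof -
        have "\<beta> + unit i \<in> keys P" using that by (auto simp: in_keys_iff lookup_pdiff)
        from Suc.prems(2)[OF this] show ?thesis by (simp add: total_degree_add)
      qed
    qed
    then have "lookup P (\<beta> + unit i) = 0" for \<beta> i
      using lookup_pdiff[of i P \<beta>] of_nat_Suc_neq_0_if_hom[OF hom] by simp
    then have "P = const (lookup P 0)"
      by (intro poly_mapping_eqI)
        (metis const_def lookup_single_eq lookup_single_not_eq nonzero_exponentE)
    with Suc.prems(1)[of 1] show ?case
      using pairing_const[of \<phi> 1 "lookup P 0"] by (simp add: is_ring_hom_simps[OF hom])
  qed
  from this[of P "Suc (Max (total_degree ` keys P))"] assms(2) show ?thesis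
    by (simp add: less_Suc_eq_le)
qed

lemma pairing_eqD:
  fixes \<phi> :: "('n::finite, 'k::field_char_0) mpoly \<Rightarrow> 'f::field"
  assumes "is_ring_hom \<phi>" and "\<And>g. pairing \<phi> g P = pairing \<phi> g Q"
  shows "P = Q"
  using pairing_nondegenerate[of \<phi> "P - Q"] assms by (simp add: pairing_diff_right)

section \<open>Multiplication by a polynomial is dual to the action of its expansion\<close>

lemma mfps_const_add: "mfps_const (a + b) = mfps_const a + mfps_const b"
  by (intro mfps_eqI) (simp add: plus_mfps.rep_eq)

lemma mfps_const_0: "mfps_const 0 = 0"
  by (intro mfps_eqI) (simp add: zero_mfps.rep_eq)

lemma eta_eq_sum:
  assumes "is_ring_hom \<iota>" and "finite B" and "keys f \<subseteq> B"
  shows "eta \<iota> f = (\<Sum>\<alpha>\<in>B. mfps_const (\<iota> (const (lookup f \<alpha>))) *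
     (\<Prod>i\<in>UNIV. (mfps_var i + mfps_const (\<iota> (var i))) ^ lookup \<alpha> i))"
  unfolding eta_def by (rule sum.mono_neutral_left)
    (use assms in \<open>auto simp: in_keys_iff mfps_const_0 is_ring_hom_simps\<close>)

lemma eta_add: "is_ring_hom \<iota> \<Longrightarrow> eta \<iota> (f + g) = eta \<iota> f + eta \<iota> g"
proof -
  assume hom: "is_ring_hom \<iota>"
  let ?B = "keys f \<union> keys g \<union> keys (f + g)"
  show ?thesis
    by (subst (1 2 3) eta_eq_sum[OF hom, of ?B])
      (auto simp: lookup_add const_add mfps_const_add is_ring_hom_simps[OF hom] distrib_right
        sum.distrib)
qed

lemma eta_single:
  "is_ring_hom \<iota> \<Longrightarrow> eta \<iota> (single \<alpha> c) = mfps_const (\<iota> (const c)) *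
     (\<Prod>i\<in>UNIV. (mfps_var i + mfps_const (\<iota> (var i))) ^ lookup \<alpha> i)"
  by (subst eta_eq_sum[of _ "{\<alpha>}"]) (simp_all add: keys_single)

lemma eta_single_add_unit:
  assumes "is_ring_hom \<iota>"
  shows "eta \<iota> (single (\<alpha> + unit i) c) =
    (mfps_var i + mfps_const (\<iota> (var i))) * eta \<iota> (single \<alpha> c)"
proof -
  let ?t = "\<lambda>i. mfps_var i + mfps_const (\<iota> (var i))"
  have "(\<Prod>j\<in>UNIV. ?t j ^ lookup (\<alpha> + unit i) j) =
      (\<Prod>j\<in>UNIV. ?t j ^ lookup \<alpha> j) * (\<Prod>j\<in>UNIV. ?t j ^ lookup (unit i) j)"
    by (simp add: lookup_add power_add prod.distrib)
  also have "(\<Prod>j\<in>UNIV. ?t j ^ lookup (unit i) j) = (\<Prod>j\<in>UNIV. if j = i then ?t j else 1)"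
    by (intro prod.cong) (simp_all add: lookup_single when_def)
  finally show ?thesis
    by (simp add: eta_single[OF assms] ac_simps)
qed

text \<open>
  Both sides are additive in \<open>f\<close>, so \<open>f\<close> may be taken to be a monomial, which is built up one variable at a
  time: \<open>pairing_var_mult\<close> moves a factor \<open>x\<^sub>i\<close> to the other side as \<open>\<iota>(x\<^sub>i) + \<partial>/\<partial>z\<^sub>i\<close>, and this is
  the action of \<open>y\<^sub>i + \<iota>(x\<^sub>i)\<close>. In this way the Taylor coefficients of \<open>eta \<iota> f\<close> never
  have to be computed.
\<close>

lemma pairing_mult:
  fixes \<iota> :: "('n::finite, 'k::field_char_0) mpoly \<Rightarrow> 'f::field"
  assumes hom: "is_ring_hom \<iota>"
  shows "pairing \<iota> (f * g) P = pairing \<iota> g (mfps_act (eta \<iota> f) P)"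
proof (induction f arbitrary: g rule: mpoly_induct)
  case (monomial \<alpha> c)
  show ?case
  proof (induction \<alpha> arbitrary: g rule: exponent_induct)
    case zero
    have "eta \<iota> (const c) = mfps_const (\<iota> (const c)) * 1"
      by (simp add: const_def eta_single[OF hom])
    then show ?case
      by (simp add: pairing_const_mult_left[OF hom] pairing_const_mult_right
          mfps_act_const_mult del: mult_1_right flip: const_def)
  next
    case (add_unit \<alpha> i)
    let ?Q = "mfps_act (eta \<iota> (single \<alpha> c)) P"
    have "single (\<alpha> + unit i) c * g = single \<alpha> c * (var i * g)"
      by (simp add: var_def mult_single flip: mult.assoc)
    then have "pairing \<iota> (single (\<alpha> + unit i) c * g) P = pairing \<iota> (var i * g) ?Q"
      by (simp add: add_unit)
    also have "\<dots> = pairing \<iota> g (const (\<iota> (var i)) * ?Q + pdiff i ?Q)"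
      by (simp add: pairing_var_mult[OF hom] pairing_add_right pairing_const_mult_right)
    also have "const (\<iota> (var i)) * ?Q + pdiff i ?Q = mfps_act (eta \<iota> (single (\<alpha> + unit i) c)) P"
      by (simp add: eta_single_add_unit[OF hom] distrib_right mfps_act_add mfps_act_var_mult
          mfps_act_const_mult)
    finally show ?case .
  qed
qed (simp add: eta_add[OF hom] mfps_act_add distrib_right pairing_add_left[OF hom]
    pairing_add_right)

context
  fixes \<iota> :: "('n::finite, 'k::field_char_0) mpoly \<Rightarrow> 'f::field"
  assumes hom: "is_ring_hom \<iota>"
begin

lemma pairing_mfps_act_vec:
  "pairing \<iota> g (mfps_act_vec (Gam \<iota> w) A) = (\<Sum>j\<in>UNIV. pairing \<iota> (w $ j * g) (A $ j))"
  by (simp add: mfps_act_vec_def Gam_def pairing_sum_right pairing_mult[OF hom])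

lemma mfps_act_vec_Gam_scale:
  "mfps_act_vec (Gam \<iota> (f *s w)) A = mfps_act (eta \<iota> f) (mfps_act_vec (Gam \<iota> w) A)"
  by (rule pairing_eqD[OF hom])
    (simp add: pairing_mfps_act_vec pairing_mult[OF hom, symmetric] ac_simps)

lemma mfps_act_vec_Gam_add:
  "mfps_act_vec (Gam \<iota> (u + w)) A = mfps_act_vec (Gam \<iota> u) A + mfps_act_vec (Gam \<iota> w) A"
  by (simp add: mfps_act_vec_def Gam_def eta_add[OF hom] mfps_act_add sum.distrib)

text \<open>
  The constant term is visible in the action on the polynomial \<open>1\<close>, and can then be read off
  from \<open>pairing_mult\<close>.
\<close>

lemma mfps_nth_eta_0: "mfps_nth (eta \<iota> f) 0 = \<iota> f"
proof -
  have "mdiff \<alpha> (const 1 :: ('n, 'f) mpoly) = 0" if nz: "\<alpha> \<noteq> 0" for \<alpha>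
  proof -
    obtain i \<beta> where "\<alpha> = \<beta> + unit i" using nz by (rule nonzero_exponentE)
    moreover have "lookup (mdiff (\<beta> + unit i) (const 1 :: ('n, 'f) mpoly)) \<gamma> = 0" for \<gamma>
    proof (rule ccontr)
      assume "lookup (mdiff (\<beta> + unit i) (const 1 :: ('n, 'f) mpoly)) \<gamma> \<noteq> 0"
      from lookup_mdiff_nonzero[OF this] have "\<beta> + unit i + \<gamma> = 0" by (simp add: const_def)
      then have "total_degree (\<beta> + unit i + \<gamma>) = 0" by (simp add: total_degree_eq_0_iff)
      then show False by (simp add: total_degree_add)
    qed
    ultimately show ?thesis by (intro poly_mapping_eqI) simp
  qed
  then have "mfps_act (eta \<iota> f) (const 1) = (\<Sum>\<beta>\<in>{0}. const (mfps_nth (eta \<iota> f) \<beta>) * mdiff \<beta> (const 1))"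
    by (intro mfps_act_eq_sum) auto
  with pairing_mult[OF hom, of f 1 "const 1"] show ?thesis
    using pairing_const[of \<iota> f 1] pairing_const[of \<iota> 1 "mfps_nth (eta \<iota> f) 0"]
    by (simp add: is_ring_hom_simps[OF hom])
qed

end

section \<open>Pulling back an inverse system gives a primary submodule\<close>

lemma mfps_act_degree_less:
  assumes "mfps_nth v 0 = 0" and "\<beta> \<in> keys (mfps_act v A)"
  shows "\<exists>\<gamma>\<in>keys A. total_degree \<beta> < total_degree \<gamma>"
proof -
  obtain \<alpha> where \<alpha>: "mfps_nth v \<alpha> * lookup (mdiff \<alpha> A) \<beta> \<noteq> 0"
    using assms(2) unfolding in_keys_iff lookup_mfps_act by (meson sum.neutral)
  then have "\<alpha> \<noteq> 0" using assms(1) by auto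
  moreover have "\<alpha> + \<beta> \<in> keys A"
    using \<alpha> by (intro lookup_mdiff_nonzero) auto
  ultimately show ?thesis
    using total_degree_eq_0_iff[of \<alpha>] by (intro bexI[of _ "\<alpha> + \<beta>"]) (simp_all add: total_degree_add)
qed

text \<open>
  A coefficient of \<open>A\<close> of maximal degree is only scaled by the constant term of \<open>v\<close>, since all other
  terms of \<open>v\<close> contribute coefficients of \<open>A\<close> of still higher degree.
\<close>

lemma mfps_act_eq_0D:
  fixes v :: "('n::finite, 'f::field) mfps"
  assumes "mfps_nth v 0 \<noteq> 0" and "mfps_act v A = 0"
  shows "A = 0"
proof (rule ccontr)
  assume A: "A \<noteq> 0"
  have fin: "finite (total_degree ` keys A)" by simp
  have ne: "total_degree ` keys A \<noteq> {}" using A by simp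
  obtain \<beta> where \<beta>: "\<beta> \<in> keys A" "total_degree \<beta> = Max (total_degree ` keys A)"
    using Max_in[OF fin ne] by auto
  have "lookup (mdiff \<alpha> A) \<beta> = 0" if "\<alpha> \<noteq> 0" for \<alpha>
  proof (rule ccontr)
    assume "lookup (mdiff \<alpha> A) \<beta> \<noteq> 0"
    then have "\<alpha> + \<beta> \<in> keys A" by (rule lookup_mdiff_nonzero)
    then have "total_degree (\<alpha> + \<beta>) \<le> total_degree \<beta>"
      unfolding \<beta>(2) by simp
    with that show False by (simp add: total_degree_add total_degree_eq_0_iff)
  qed
  then have "lookup (mfps_act v A) \<beta> = (\<Sum>\<alpha>\<in>{0}. mfps_nth v \<alpha> * lookup (mdiff \<alpha> A) \<beta>)"
    unfolding lookup_mfps_act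
    by (intro sum.mono_neutral_right) (use A finite_mdiff_support[of A] in auto)
  with \<beta>(1) assms show False by (simp add: in_keys_iff)
qed

lemma module_vec: "module ((*s) :: 'a::comm_ring_1 \<Rightarrow> 'a ^ 'r::finite \<Rightarrow> 'a ^ 'r)"
  by (simp add: module_def vec_eq_iff algebra_simps)

lemma module_self: "module ((*) :: 'a::comm_ring_1 \<Rightarrow> 'a \<Rightarrow> 'a)"
  by (simp add: module_def algebra_simps)

lemma vec_scale_scale: "a *s (b *s u) = (a * b) *s (u :: 'a::comm_ring_1 ^ 'r::finite)"
  by (simp add: vec_eq_iff mult.assoc)

context
  fixes \<iota> :: "('n::finite, 'k::field_char_0) mpoly \<Rightarrow> 'f::field"
  assumes hom: "is_ring_hom \<iota>"
begin

lemma mfps_act_vec_Gam_0: "mfps_act_vec (Gam \<iota> 0) A = 0"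
  using mfps_act_vec_Gam_add[OF hom, of 0 0 A] by simp

lemma mfps_act_0_right: "mfps_act v 0 = 0"
  by (intro poly_mapping_eqI) (simp add: lookup_mfps_act)

lemma subspace_Gam_vimage: "module.subspace (*s) (Gam \<iota> -` inverse_system S)"
  unfolding module.subspace_def[OF module_vec] inverse_system_def
  by (simp add: mfps_act_vec_Gam_0 mfps_act_vec_Gam_add[OF hom] mfps_act_vec_Gam_scale[OF hom]
      mfps_act_0_right)

lemma prime_ideal_ker: "prime_ideal {f. \<iota> f = 0}"
  by (simp add: prime_ideal_def module.subspace_def[OF module_self] is_ring_hom_simps[OF hom])

lemma mfps_act_vec_Gam_axis: "mfps_act_vec (Gam \<iota> (axis j 1)) A = A $ j"
proof -
  have "eta \<iota> 0 = 0" using eta_add[OF hom, of 0 0] by simp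
  moreover have "eta \<iota> 1 = 1"
    using eta_single[OF hom, of 0 1] by (simp add: const_def[symmetric] is_ring_hom_simps[OF hom])
      (auto intro: mfps_eqI simp: one_mfps.rep_eq)
  moreover have "mfps_act 0 B = 0" for B :: "('n, 'f) mpoly"
    using mfps_act_add[of 0 0 B] by simp
  ultimately have "mfps_act_vec (Gam \<iota> (axis j 1)) A = (\<Sum>i\<in>UNIV. if i = j then A $ i else 0)"
    unfolding mfps_act_vec_def Gam_def by (intro sum.cong) (auto simp: axis_def)
  then show ?thesis by simp
qed

text \<open>
  For \<open>w\<close> in \<open>R\<^sup>r\<close> let the level of \<open>w\<close> be a bound for the degrees of the polynomials \<open>Gam(w) \<cdot> A\<close>; it
  is zero exactly on the submodule. Multiplication by an element of the kernel of \<open>\<iota>\<close> lowers the level,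
  and multiplication by any other element is injective modulo the submodule. So every prime that is an
  annihilator is the kernel, and the kernel is the annihilator of an element of least positive level.
  Such an element exists since one of the \<open>A\<close> is nonzero, which makes the submodule proper.
\<close>

lemma primary_submodule_Gam_vimage:
  fixes S :: "(('n, 'f) mpoly ^ 'r::finite) set"
  assumes "finite S" and "\<exists>A\<in>S. A \<noteq> 0"
  shows "primary_submodule {f. \<iota> f = 0} (Gam \<iota> -` inverse_system S)"
proof -
  define N where "N = Gam \<iota> -` inverse_system S"
  define B where "B d = {w. \<forall>A\<in>S. \<forall>\<beta>\<in>keys (mfps_act_vec (Gam \<iota> w) A). total_degree \<beta> < d}" for d
  have N: "w \<in> N \<longleftrightarrow> (\<forall>A\<in>S. mfps_act_vec (Gam \<iota> w) A = 0)" for w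
    by (simp add: N_def inverse_system_def)
  have B0: "B 0 = N"
    by (auto simp: B_def N)
  have regular: "w \<in> N" if "\<iota> s \<noteq> 0" and "s *s w \<in> N" for s w
    using that unfolding N mfps_act_vec_Gam_scale[OF hom]
    by (metis mfps_act_eq_0D mfps_nth_eta_0[OF hom])
  have drop: "f *s w \<in> B d" if "\<iota> f = 0" and w: "w \<in> B (Suc d)" for f w d
    unfolding B_def
  proof (safe)
    fix A \<beta> assume A: "A \<in> S" and "\<beta> \<in> keys (mfps_act_vec (Gam \<iota> (f *s w)) A)"
    then have "\<beta> \<in> keys (mfps_act (eta \<iota> f) (mfps_act_vec (Gam \<iota> w) A))"
      by (simp add: mfps_act_vec_Gam_scale[OF hom])
    moreover have "mfps_nth (eta \<iota> f) 0 = 0" using that(1) by (simp add: mfps_nth_eta_0[OF hom])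
    ultimately obtain \<gamma>
      where "\<gamma> \<in> keys (mfps_act_vec (Gam \<iota> w) A)" "total_degree \<beta> < total_degree \<gamma>"
      using mfps_act_degree_less by blast
    with w A show "total_degree \<beta> < d" by (force simp: B_def)
  qed
  have exhaust: "\<exists>d. w \<in> B d" for w
  proof -
    have "finite (\<Union>A\<in>S. total_degree ` keys (mfps_act_vec (Gam \<iota> w) A))"
      using assms(1) by simp
    then obtain d where "\<forall>n\<in>(\<Union>A\<in>S. total_degree ` keys (mfps_act_vec (Gam \<iota> w) A)). n < d"
      unfolding finite_nat_set_iff_bounded by blast
    then have "w \<in> B d" by (auto simp: B_def)
    then show ?thesis ..
  qed
  have nilpotent: "f ^ d *s w \<in> N" if "\<iota> f = 0" and "w \<in> B d" for f w d
    using that(2)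
  proof (induction d arbitrary: w)
    case 0
    then show ?case by (simp add: B0)
  next
    case (Suc d)
    from Suc.IH[OF drop[OF that(1) Suc.prems]] show ?case
      by (simp add: vec_scale_scale power_commutes)
  qed
  have "\<exists>w. w \<notin> N"
  proof -
    obtain A j where A: "A \<in> S" "A $ j \<noteq> 0"
      using assms(2) by (auto simp: vec_eq_iff)
    then have "axis j 1 \<notin> N" unfolding N by (auto simp: mfps_act_vec_Gam_axis)
    then show ?thesis ..
  qed
  then have "\<exists>d. \<exists>w. w \<in> B d \<and> w \<notin> N" using exhaust by blast
  \<comment> \<open>Such a \<open>u\<close> of minimal level has the kernel of \<open>\<iota>\<close> as annihilator.\<close>
  then obtain d u where u: "u \<in> B d" "u \<notin> N" and least: "\<And>e w. e < d \<Longrightarrow> w \<in> B e \<Longrightarrow> w \<in> N"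
    using exists_least_iff[of "\<lambda>d. \<exists>w. w \<in> B d \<and> w \<notin> N"] by blast
  have "f *s u \<in> N" if "\<iota> f = 0" for f
  proof (cases d)
    case 0
    with u B0 show ?thesis by simp
  next
    case (Suc e)
    with drop[OF that, of u e] u(1) least[of e] show ?thesis by simp
  qed
  with regular u(2) have ann: "{f. \<iota> f = 0} = {f. f *s u \<in> N}" by blast
  have "Q = {f. \<iota> f = 0}" if Q: "prime_ideal Q" "Q = {f. f *s w \<in> N}" for Q w
  proof -
    have "1 \<notin> Q" and mult: "a * b \<in> Q \<Longrightarrow> a \<in> Q \<or> b \<in> Q" for a b
      using Q(1) by (auto simp: prime_ideal_def)
    then have "w \<notin> N" unfolding Q(2) by simp
    have "f \<in> Q" if "f ^ d \<in> Q" for f d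
      using that by (induction d) (use \<open>1 \<notin> Q\<close> mult in auto)
    moreover obtain d where "w \<in> B d" using exhaust by blast
    ultimately have "f \<in> Q" if "\<iota> f = 0" for f
      using nilpotent[OF that] unfolding Q(2) by blast
    with regular \<open>w \<notin> N\<close> show ?thesis unfolding Q(2) by blast
  qed
  then have "ass_quot N = {{f. \<iota> f = 0}}"
    using prime_ideal_ker ann unfolding ass_quot_def by blast
  with subspace_Gam_vimage[of S] show ?thesis
    by (simp add: primary_submodule_def N_def)
qed

end

section \<open>The symbol of a differential operator\<close>

definition has_symbol ::
    "(('n::finite, 'k::field_char_0) mpoly \<Rightarrow> ('n, 'k) mpoly) \<Rightarrow> ('n, ('n, 'k) mpoly) mpoly \<Rightarrow> bool" where
  "has_symbol D a \<longleftrightarrow> (\<forall>w. D w = pairing (\<lambda>f. f) w a)"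

text \<open>
  By the Leibniz rule, composing \<open>f \<partial>\<^sup>\<alpha>\<close> with \<open>\<partial>\<^sub>i\<close> on the left gives \<open>f \<partial>\<^sub>i \<partial>\<^sup>\<alpha> + (\<partial>\<^sub>i f) \<partial>\<^sup>\<alpha>\<close>.
\<close>

lemma pdiff_has_symbol:
  assumes "has_symbol E a"
  shows "\<exists>b. has_symbol (\<lambda>w. pdiff i (E w)) b"
proof -
  define b where "b = (\<Sum>\<alpha>\<in>keys a. single (\<alpha> + unit i) (lookup a \<alpha>) + single \<alpha> (pdiff i (lookup a \<alpha>)))"
  have "pdiff i (E w) = pairing (\<lambda>f. f) w b" for w
    using assms by (simp add: has_symbol_def b_def pairing_sum_right pairing_add_right pairing_single mdiff_add_unit)
      (simp add: pairing_def pdiff_sum pdiff_mult)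
  then show ?thesis unfolding has_symbol_def by blast
qed

text \<open>
  Operators in normal form are not obviously closed under composition, but they are closed under
  composition with the generators on the left. The induction therefore shows that all of the Weyl
  algebra preserves normal forms under left composition, and the identity has a normal form.
\<close>

lemma weyl_algebra_has_symbol:
  assumes "D \<in> weyl_algebra"
  shows "\<exists>a. has_symbol D a"
proof -
  have "\<exists>a. has_symbol (\<lambda>w. D (E w)) a" if "D \<in> weyl_algebra" and "\<exists>a. has_symbol E a" for D E
    using that
  proof (induction arbitrary: E)
    case (mult f)
    then obtain a where "has_symbol E a" by blast
    then have "has_symbol (\<lambda>w. f * E w) (const f * a)"
      by (simp add: has_symbol_def pairing_const_mult_right)
    then show ?case ..
  next
    case (pdiff i)
    then show ?case using pdiff_has_symbol by blast
  next
    case (add D D')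
    then obtain a b where "has_symbol (\<lambda>w. D (E w)) a" "has_symbol (\<lambda>w. D' (E w)) b" by meson
    then have "has_symbol (\<lambda>w. D (E w) + D' (E w)) (a + b)"
      by (simp add: has_symbol_def pairing_add_right)
    then show ?case ..
  next
    case (comp D D')
    then show ?case by blast
  qed
  moreover have "has_symbol (\<lambda>w. w) (const 1)"
    unfolding has_symbol_def pairing_const by simp
  ultimately show ?thesis using assms by blast
qed

section \<open>The tensor product\<close>

lemma tensor_rel_uminus: "x \<in> tensor_rel \<iota> \<Longrightarrow> - x \<in> tensor_rel \<iota>"
  using tensor_rel.diff[OF tensor_rel.zero] by fastforce

lemma tensor_rel_add: "x \<in> tensor_rel \<iota> \<Longrightarrow> y \<in> tensor_rel \<iota> \<Longrightarrow> x + y \<in> tensor_rel \<iota>"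
  using tensor_rel.diff[OF _ tensor_rel_uminus] by fastforce

lemma tensor_rel_sum: "(\<And>x. x \<in> B \<Longrightarrow> f x \<in> tensor_rel \<iota>) \<Longrightarrow> sum f B \<in> tensor_rel \<iota>"
  by (induction B rule: infinite_finite_induct) (auto intro: tensor_rel.zero tensor_rel_add)

lemma tensor_class_eq_iff: "tensor_class \<iota> x = tensor_class \<iota> y \<longleftrightarrow> x - y \<in> tensor_rel \<iota>"
proof
  assume "tensor_class \<iota> x = tensor_class \<iota> y"
  moreover have "x \<in> tensor_class \<iota> x" by (simp add: tensor_class_def tensor_rel.zero)
  ultimately show "x - y \<in> tensor_rel \<iota>" by (simp add: tensor_class_def)
next
  assume *: "x - y \<in> tensor_rel \<iota>"
  have "z - x \<in> tensor_rel \<iota> \<longleftrightarrow> z - y \<in> tensor_rel \<iota>" for z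
    using tensor_rel_add[OF _ *, of "z - x"] tensor_rel.diff[OF _ *, of "z - y"] by auto
  then show "tensor_class \<iota> x = tensor_class \<iota> y" by (simp add: tensor_class_def)
qed

text \<open>
  The linear functional \<open>a \<otimes> \<delta> \<mapsto> a \<iota> (\<delta>\<^sub>j g)\<close>. It is well defined on the tensor product by
  \<open>tensor_eval_tensor_rel\<close>, and on the image of \<open>A\<close> it is the pairing with \<open>A\<^sub>j\<close>.
\<close>

definition tensor_eval ::
    "(('n, 'k::field_char_0) mpoly \<Rightarrow> 'f::field) \<Rightarrow> 'r::finite \<Rightarrow> ('n, 'k) mpoly \<Rightarrow>
      (('f \<times> ('n, 'k, 'r) dop) \<Rightarrow>\<^sub>0 int) \<Rightarrow> 'f" where
  "tensor_eval \<iota> j g x = (\<Sum>p\<in>keys x. of_int (lookup x p) * (fst p * \<iota> ((snd p $ j) g)))"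

lemma tensor_eval_eq_sum:
  "finite B \<Longrightarrow> keys x \<subseteq> B \<Longrightarrow>
    tensor_eval \<iota> j g x = (\<Sum>p\<in>B. of_int (lookup x p) * (fst p * \<iota> ((snd p $ j) g)))"
  unfolding tensor_eval_def by (rule sum.mono_neutral_left) (auto simp: in_keys_iff)

lemma tensor_eval_diff: "tensor_eval \<iota> j g (x - y) = tensor_eval \<iota> j g x - tensor_eval \<iota> j g y"
proof -
  let ?B = "keys x \<union> keys y \<union> keys (x - y)"
  show ?thesis
    by (subst (1 2 3) tensor_eval_eq_sum[of ?B])
      (auto simp: lookup_minus left_diff_distrib sum_subtractf)
qed

lemma tensor_eval_0 [simp]: "tensor_eval \<iota> j g 0 = 0"
  by (simp add: tensor_eval_def)

lemma tensor_eval_add: "tensor_eval \<iota> j g (x + y) = tensor_eval \<iota> j g x + tensor_eval \<iota> j g y"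
  using tensor_eval_diff[of \<iota> j g "x + y" y] by simp

lemma tensor_eval_sum: "tensor_eval \<iota> j g (sum x B) = (\<Sum>b\<in>B. tensor_eval \<iota> j g (x b))"
  by (induction B rule: infinite_finite_induct) (simp_all add: tensor_eval_add)

lemma tensor_eval_frag_of: "tensor_eval \<iota> j g (frag_of (a, \<delta>)) = a * \<iota> ((\<delta> $ j) g)"
  by (simp add: tensor_eval_def)

lemma tensor_eval_tensor_rel:
  "is_ring_hom \<iota> \<Longrightarrow> x \<in> tensor_rel \<iota> \<Longrightarrow> tensor_eval \<iota> j g x = 0"
  by (erule tensor_rel.induct)
    (simp_all add: tensor_eval_diff tensor_eval_frag_of is_ring_hom_simps dop_add_def dop_lmult_def
      distrib_left distrib_right mult.assoc)

definition tensor_rep where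
  "tensor_rep A = (\<Sum>j\<in>UNIV. \<Sum>\<alpha>\<in>keys (A $ j). frag_of (lookup (A $ j) \<alpha>, dop_axis j (mdiff \<alpha>)))"

lemma Psi_eq: "Psi \<iota> A = tensor_class \<iota> (tensor_rep A)"
  by (simp add: Psi_def tensor_rep_def)

lemma tensor_eval_tensor_rep:
  assumes "is_ring_hom \<iota>"
  shows "tensor_eval \<iota> j g (tensor_rep A) = pairing \<iota> g (A $ j)"
proof -
  have "tensor_eval \<iota> j g (tensor_rep A) =
      (\<Sum>i\<in>UNIV. if i = j then pairing \<iota> g (A $ i) else 0)"
    unfolding tensor_rep_def tensor_eval_sum tensor_eval_frag_of
    by (intro sum.cong)
      (auto simp: dop_axis_def pairing_def is_ring_hom_simps[OF assms] mult.commute)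
  then show ?thesis by simp
qed


lemma zero_in_weyl_algebra: "(\<lambda>w. 0) \<in> weyl_algebra"
proof -
  have "(\<lambda>w. 0 * w) \<in> weyl_algebra" by (rule weyl_algebra.mult)
  then show ?thesis by (simp only: mult_zero_left)
qed

lemma mdiff_in_weyl_algebra:
  fixes \<alpha> :: "'n::finite \<Rightarrow>\<^sub>0 nat"
  shows "(mdiff \<alpha> :: ('n, 'k::field_char_0) mpoly \<Rightarrow> ('n, 'k) mpoly) \<in> weyl_algebra"
proof (induction \<alpha> rule: exponent_induct)
  case zero
  have "(mdiff 0 :: ('n, 'k) mpoly \<Rightarrow> _) = (\<lambda>w. 1 * w)" by auto
  then show ?case by (simp only: weyl_algebra.mult)
next
  case (add_unit \<alpha> i)
  have "(mdiff (\<alpha> + unit i) :: ('n, 'k) mpoly \<Rightarrow> _) = (\<lambda>w. pdiff i (mdiff \<alpha> w))"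
    by (auto simp: mdiff_add_unit)
  then show ?case by (simp only: weyl_algebra.comp[OF weyl_algebra.pdiff add_unit])
qed

lemma dop_axis_in_weyl_vecs: "D \<in> weyl_algebra \<Longrightarrow> dop_axis j D \<in> weyl_vecs"
  by (simp add: weyl_vecs_def dop_axis_def zero_in_weyl_algebra)

lemma dop_zero_in_weyl_vecs: "dop_zero \<in> weyl_vecs"
  by (simp add: weyl_vecs_def dop_zero_def zero_in_weyl_algebra)

lemma dop_add_in_weyl_vecs: "\<delta> \<in> weyl_vecs \<Longrightarrow> \<epsilon> \<in> weyl_vecs \<Longrightarrow> dop_add \<delta> \<epsilon> \<in> weyl_vecs"
  by (simp add: weyl_vecs_def dop_add_def weyl_algebra.add)

lemma dop_lmult_in_weyl_vecs: "\<delta> \<in> weyl_vecs \<Longrightarrow> dop_lmult f \<delta> \<in> weyl_vecs"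
  using weyl_algebra.comp[OF weyl_algebra.mult[of f]] by (simp add: weyl_vecs_def dop_lmult_def)

definition dop_sum :: "('b \<Rightarrow> ('n, 'k::field_char_0, 'r::finite) dop) \<Rightarrow> 'b set \<Rightarrow> ('n, 'k, 'r) dop" where
  "dop_sum D B = (\<chi> j. (\<lambda>w. \<Sum>b\<in>B. (D b $ j) w))"

lemma frag_of_dop_sum:
  fixes D :: "'b \<Rightarrow> ('n, 'k::field_char_0, 'r::finite) dop" and \<iota> :: "('n, 'k) mpoly \<Rightarrow> 'f::field"
  assumes "finite B" and "\<And>b. b \<in> B \<Longrightarrow> D b \<in> weyl_vecs"
  shows "dop_sum D B \<in> weyl_vecs \<and>
    frag_of (a, dop_sum D B) - (\<Sum>b\<in>B. frag_of (a, D b)) \<in> tensor_rel \<iota>"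
  using assms
proof (induction B)
  case empty
  have *: "dop_sum D {} = dop_zero" "dop_add dop_zero dop_zero = dop_zero"
    by (simp_all add: dop_sum_def dop_zero_def dop_add_def)
  from tensor_rel_uminus[OF tensor_rel.add_right[OF dop_zero_in_weyl_vecs dop_zero_in_weyl_vecs, of a \<iota>]]
  show ?case by (simp add: * dop_zero_in_weyl_vecs)
next
  case (insert b B)
  then have IH: "dop_sum D B \<in> weyl_vecs"
      "frag_of (a, dop_sum D B) - (\<Sum>b\<in>B. frag_of (a, D b)) \<in> tensor_rel \<iota>"
    and b: "D b \<in> weyl_vecs" by auto
  have *: "dop_sum D (insert b B) = dop_add (D b) (dop_sum D B)"
    using insert.hyps by (simp add: dop_sum_def dop_add_def)
  have telescope: "(x - y - z) + (z - w) = x - (y + w)"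
    for w x y z :: "('f \<times> ('n, 'k, 'r) dop) \<Rightarrow>\<^sub>0 int"
    by simp
  show ?case
    unfolding * sum.insert[OF insert.hyps]
    using dop_add_in_weyl_vecs[OF b IH(1)]
      tensor_rel_add[OF tensor_rel.add_right[OF b IH(1), of a] IH(2)]
    by (simp only: telescope simp_thms)
qed

lemma frag_of_0_in_tensor_rel: "\<delta> \<in> weyl_vecs \<Longrightarrow> frag_of (0, \<delta>) \<in> tensor_rel \<iota>"
  using tensor_rel_uminus[OF tensor_rel.add_left[of \<delta> 0 0 \<iota>]] by simp

text \<open>
  Write \<open>\<delta> = \<Sum> c\<^sub>p e\<^sub>p\<close> with \<open>p\<close> running over pairs \<open>(j, \<alpha>)\<close> and \<open>e\<^sub>p = \<partial>\<^sup>\<alpha>\<close> in coordinate \<open>j\<close>. In the tensor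
  product \<open>1 \<otimes> \<delta> = \<Sum> 1 \<otimes> c\<^sub>p e\<^sub>p = \<Sum> \<iota>(c\<^sub>p) \<otimes> e\<^sub>p\<close>, which is the image of the polynomial vector with
  coefficients \<open>\<iota>(c\<^sub>p)\<close>.
\<close>

lemma Phi_in_range_Psi:
  fixes \<iota> :: "('n::finite, 'k::field_char_0) mpoly \<Rightarrow> 'f::field"
    and \<delta> :: "('n, 'k, 'r::finite) dop"
  assumes hom: "is_ring_hom \<iota>" and \<delta>: "\<delta> \<in> weyl_vecs"
  shows "Phi \<iota> \<delta> \<in> range (Psi \<iota>)"
proof -
  have "\<forall>j. \<exists>a. has_symbol (\<delta> $ j) a"
    using \<delta> weyl_algebra_has_symbol by (auto simp: weyl_vecs_def)
  then obtain a where a: "\<And>j. has_symbol (\<delta> $ j) (a j)" by metis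
  define A :: "('n, 'f) mpoly ^ 'r"
    where "A = (\<chi> j. \<Sum>\<alpha>\<in>keys (a j). single \<alpha> (\<iota> (lookup (a j) \<alpha>)))"
  define e :: "'r \<times> ('n \<Rightarrow>\<^sub>0 nat) \<Rightarrow> ('n, 'k, 'r) dop"
    where "e p = dop_axis (fst p) (mdiff (snd p))" for p
  define c where "c p = lookup (a (fst p)) (snd p)" for p
  define S where "S = (SIGMA j:UNIV. keys (a j))"
  have fin: "finite S" by (simp add: S_def)
  have e: "e p \<in> weyl_vecs" for p
    by (simp add: e_def dop_axis_in_weyl_vecs mdiff_in_weyl_algebra)
  have A: "lookup (A $ j) \<alpha> = \<iota> (lookup (a j) \<alpha>)" for j \<alpha>
    by (simp add: A_def lookup_sum lookup_single when_def in_keys_iff is_ring_hom_simps[OF hom])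
  have "(\<delta> $ i) w = (dop_sum (\<lambda>p. dop_lmult (c p) (e p)) S $ i) w" for i w
  proof -
    have "(dop_sum (\<lambda>p. dop_lmult (c p) (e p)) S $ i) w =
        (\<Sum>j\<in>UNIV. \<Sum>\<alpha>\<in>keys (a j). lookup (a j) \<alpha> * (dop_axis j (mdiff \<alpha>) $ i) w)"
      by (simp add: dop_sum_def dop_lmult_def c_def e_def S_def sum.Sigma case_prod_unfold)
    also have "\<dots> = (\<Sum>j\<in>UNIV. if j = i then pairing (\<lambda>f. f) w (a j) else 0)"
      by (intro sum.cong) (auto simp: dop_axis_def pairing_def mult.commute)
    finally show ?thesis using a[of i] by (simp add: has_symbol_def)
  qed
  then have \<delta>_eq: "\<delta> = dop_sum (\<lambda>p. dop_lmult (c p) (e p)) S"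
    by (simp add: vec_eq_iff fun_eq_iff)
  have 1: "frag_of (1, \<delta>) - (\<Sum>p\<in>S. frag_of (1, dop_lmult (c p) (e p))) \<in> tensor_rel \<iota>"
    unfolding \<delta>_eq by (rule conjunct2[OF frag_of_dop_sum[OF fin dop_lmult_in_weyl_vecs[OF e]]])
  have "(\<Sum>p\<in>S. frag_of (\<iota> (c p), e p) - frag_of (1, dop_lmult (c p) (e p))) \<in> tensor_rel \<iota>"
    using tensor_rel.balanced[OF e, of 1 \<iota>] by (intro tensor_rel_sum) simp
  then have 2: "(\<Sum>p\<in>S. frag_of (\<iota> (c p), e p)) - (\<Sum>p\<in>S. frag_of (1, dop_lmult (c p) (e p)))
      \<in> tensor_rel \<iota>"
    by (simp only: sum_subtractf)
  \<comment> \<open>The representative of \<open>Psi \<iota> A\<close> omits the terms with \<open>\<iota>(c\<^sub>p) = 0\<close>; they are \<open>0 \<otimes> e\<^sub>p\<close>.\<close>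
  have "tensor_rep A = (\<Sum>j\<in>UNIV. \<Sum>\<alpha>\<in>keys (a j).
      if \<iota> (c (j, \<alpha>)) = 0 then 0 else frag_of (\<iota> (c (j, \<alpha>)), e (j, \<alpha>)))"
    unfolding tensor_rep_def
    by (intro sum.cong sum.mono_neutral_cong_left)
      (auto simp: A c_def e_def in_keys_iff is_ring_hom_simps[OF hom])
  also have "\<dots> = (\<Sum>p\<in>S. if \<iota> (c p) = 0 then 0 else frag_of (\<iota> (c p), e p))"
    unfolding S_def by (subst sum.Sigma) (auto intro!: sum.cong)
  finally have "(\<Sum>p\<in>S. frag_of (\<iota> (c p), e p)) - tensor_rep A =
      (\<Sum>p\<in>S. if \<iota> (c p) = 0 then frag_of (0, e p) else 0)"
    by (simp add: sum_subtractf[symmetric]) (intro sum.cong, auto)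
  also have "\<dots> \<in> tensor_rel \<iota>"
    by (intro tensor_rel_sum) (simp add: frag_of_0_in_tensor_rel e tensor_rel.zero)
  finally have 3: "(\<Sum>p\<in>S. frag_of (\<iota> (c p), e p)) - tensor_rep A \<in> tensor_rel \<iota>" .
  have telescope: "(x - y) - (z - y) + (z - w) = x - w"
    for w x y z :: "('f \<times> ('n, 'k, 'r) dop) \<Rightarrow>\<^sub>0 int"
    by simp
  have "frag_of (1, \<delta>) - tensor_rep A \<in> tensor_rel \<iota>"
    using tensor_rel_add[OF tensor_rel.diff[OF 1 2] 3] by (simp only: telescope)
  then show ?thesis
    by (auto simp: Phi_def Psi_eq tensor_class_eq_iff)
qed

lemma pairing_inv_Psi:
  fixes \<iota> :: "('n::finite, 'k::field_char_0) mpoly \<Rightarrow> 'f::field"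
    and \<delta> :: "('n, 'k, 'r::finite) dop"
  assumes hom: "is_ring_hom \<iota>" and "\<delta> \<in> weyl_vecs"
  shows "pairing \<iota> g (inv (Psi \<iota>) (Phi \<iota> \<delta>) $ j) = \<iota> ((\<delta> $ j) g)"
proof -
  let ?A = "inv (Psi \<iota>) (Phi \<iota> \<delta>)"
  have "Psi \<iota> ?A = Phi \<iota> \<delta>"
    by (rule f_inv_into_f[OF Phi_in_range_Psi[OF assms]])
  then have "tensor_rep ?A - frag_of (1, \<delta>) \<in> tensor_rel \<iota>"
    by (simp add: Psi_eq Phi_def tensor_class_eq_iff)
  from tensor_eval_tensor_rel[OF hom this, of j g] show ?thesis
    by (simp add: tensor_eval_diff tensor_eval_frag_of tensor_eval_tensor_rep[OF hom])
qed

section \<open>Residue fields and bimodules\<close>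

text \<open>
  That the kernel is no larger than \<open>P\<close> holds because the fractions with numerator in \<open>P\<close> form an ideal,
  called \<open>T\<close> below, and primality allows one to clear denominators.
\<close>

lemma residue_field_map:
  assumes "is_residue_field P loc res" and "prime_ideal P"
  shows "is_ring_hom (res \<circ> loc)" and "(res \<circ> loc) a = 0 \<longleftrightarrow> a \<in> P"
proof -
  have loc: "is_ring_hom loc" and res: "is_ring_hom res"
    and ker: "{x. res x = 0} = module.span (*) (loc ` P)"
    and frac: "\<And>x. \<exists>a s. s \<notin> P \<and> x * loc s = loc a"
    and loc0: "\<And>a. loc a = 0 \<Longrightarrow> \<exists>s. s \<notin> P \<and> s * a = 0"
    using assms(1) unfolding is_residue_field_def is_localization_at_def by auto
  note loc_simps = is_ring_hom_simps[OF loc]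
  show "is_ring_hom (res \<circ> loc)"
    using loc res by (simp add: is_ring_hom_def)
  have P: "0 \<in> P" "1 \<notin> P" "\<And>a b. a \<in> P \<Longrightarrow> b \<in> P \<Longrightarrow> a + b \<in> P" "\<And>a b. b \<in> P \<Longrightarrow> a * b \<in> P"
      "\<And>a b. a * b \<in> P \<Longrightarrow> a \<in> P \<or> b \<in> P"
    using assms(2) by (auto simp: prime_ideal_def module.subspace_def[OF module_self])
  define T where "T = {x. \<exists>a s. a \<in> P \<and> s \<notin> P \<and> x * loc s = loc a}"
  have T_iff: "x \<in> T \<longleftrightarrow> (\<exists>a s. a \<in> P \<and> s \<notin> P \<and> x * loc s = loc a)" for x
    by (simp add: T_def)
  have "module.subspace (*) T"
    unfolding module.subspace_def[OF module_self]
  proof (intro conjI ballI allI)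
    show "0 \<in> T" unfolding T_iff using P(1,2) by (metis loc_simps(4) mult_zero_left)
  next
    fix x y assume "x \<in> T" "y \<in> T"
    then obtain a s b t where *: "a \<in> P" "s \<notin> P" "x * loc s = loc a" "b \<in> P" "t \<notin> P" "y * loc t = loc b"
      unfolding T_iff by blast
    have "(x + y) * loc (s * t) = (x * loc s) * loc t + (y * loc t) * loc s"
      by (simp add: loc_simps(3) algebra_simps)
    also have "\<dots> = loc (t * a + s * b)"
      by (simp add: *(3,6) loc_simps(2,3) mult.commute)
    finally have "(x + y) * loc (s * t) = loc (t * a + s * b)" .
    moreover have "t * a + s * b \<in> P" "s * t \<notin> P"
      using P(3)[OF P(4)[OF *(1)] P(4)[OF *(4)]] P(5) *(2,5) by auto
    ultimately show "x + y \<in> T" unfolding T_iff by blast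
  next
    fix r x assume "x \<in> T"
    then obtain a s where *: "a \<in> P" "s \<notin> P" "x * loc s = loc a" unfolding T_iff by blast
    obtain b t where **: "t \<notin> P" "r * loc t = loc b" using frac by blast
    have "(r * x) * loc (t * s) = (r * loc t) * (x * loc s)"
      by (simp add: loc_simps(3) algebra_simps)
    also have "\<dots> = loc (b * a)" by (simp add: *(3) **(2) loc_simps(3))
    finally have "(r * x) * loc (t * s) = loc (b * a)" .
    moreover have "b * a \<in> P" "t * s \<notin> P"
      using P(4)[OF *(1)] P(5) *(2) **(1) by auto
    ultimately show "r * x \<in> T" unfolding T_iff by blast
  qed
  moreover have "loc ` P \<subseteq> T"
    using P(2) by (auto simp: T_iff) (metis loc_simps(1) mult_1_right)
  ultimately have span: "module.span (*) (loc ` P) \<subseteq> T"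
    by (intro module.span_minimal[OF module_self])
  show "(res \<circ> loc) a = 0 \<longleftrightarrow> a \<in> P"
  proof
    assume "(res \<circ> loc) a = 0"
    then have "loc a \<in> T" using ker span by auto
    then obtain b s where b: "b \<in> P" "s \<notin> P" "loc a * loc s = loc b" unfolding T_iff by blast
    then have "loc (a * s - b) = 0" by (simp add: loc_simps)
    then obtain t where t: "t \<notin> P" "t * (a * s - b) = 0" using loc0 by blast
    then have "t * (s * a) = t * b" by (simp add: algebra_simps)
    then have "t * (s * a) \<in> P" using P(4) b(1) by simp
    then show "a \<in> P" using P(5) t(1) b(2) by blast
  next
    assume "a \<in> P"
    then have "loc a \<in> module.span (*) (loc ` P)"
      by (intro module.span_base[OF module_self]) simp
    then show "(res \<circ> loc) a = 0" using ker by auto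
  qed
qed

lemma dop_apply_simps:
  "dop_apply dop_zero w = 0"
  "dop_apply (dop_add \<delta> \<epsilon>) w = dop_apply \<delta> w + dop_apply \<epsilon> w"
  "dop_apply (dop_lmult f \<delta>) w = f * dop_apply \<delta> w"
  "dop_apply (dop_rmult \<delta> f) w = dop_apply \<delta> (f *s w)"
  by (simp_all add: dop_apply_def dop_zero_def dop_add_def dop_lmult_def dop_rmult_def
      sum.distrib sum_distrib_left)

text \<open>
  Left multiplication and addition are absorbed by the ideal, so only right multiplications enlarge
  the set of conditions on \<open>w\<close>. In the induction the multiplier \<open>g\<close> is arbitrary so that it can absorb them.
\<close>

lemma bimodule_gen_apply_in_ideal_iff:
  assumes "module.subspace (*) P"
  shows "(\<forall>\<epsilon>\<in>bimodule_gen S. dop_apply \<epsilon> w \<in> P) \<longleftrightarrow> (\<forall>\<delta>\<in>S. \<forall>g. dop_apply \<delta> (g *s w) \<in> P)"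
proof (intro iffI ballI allI)
  fix \<delta> g
  assume "\<forall>\<epsilon>\<in>bimodule_gen S. dop_apply \<epsilon> w \<in> P" and "\<delta> \<in> S"
  then show "dop_apply \<delta> (g *s w) \<in> P"
    unfolding dop_apply_simps(4)[symmetric] by (blast intro: bimodule_gen.intros)
next
  fix \<epsilon>
  assume S: "\<forall>\<delta>\<in>S. \<forall>g. dop_apply \<delta> (g *s w) \<in> P" and "\<epsilon> \<in> bimodule_gen S"
  from this(2) have "dop_apply \<epsilon> (g *s w) \<in> P" for g
  proof (induction arbitrary: g)
    case (rmult \<delta> f)
    from rmult.IH[of "f * g"] show ?case by (simp add: dop_apply_simps vec_scale_scale)
  qed (use S assms in \<open>simp_all add: dop_apply_simps module.subspace_def[OF module_self]\<close>)
  from this[of 1] show "dop_apply \<epsilon> w \<in> P" by simp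
qed

section \<open>Correctness of the algorithm\<close>

lemma mfps_act_vec_inv_Psi_eq_0_iff:
  fixes \<iota> :: "('n::finite, 'k::field_char_0) mpoly \<Rightarrow> 'f::field"
    and \<delta> :: "('n, 'k, 'r::finite) dop"
  assumes hom: "is_ring_hom \<iota>" and \<delta>: "\<delta> \<in> weyl_vecs"
  shows "mfps_act_vec (Gam \<iota> w) (inv (Psi \<iota>) (Phi \<iota> \<delta>)) = 0 \<longleftrightarrow> (\<forall>g. \<iota> (dop_apply \<delta> (g *s w)) = 0)"
proof -
  let ?P = "mfps_act_vec (Gam \<iota> w) (inv (Psi \<iota>) (Phi \<iota> \<delta>))"
  have "pairing \<iota> g ?P = \<iota> (dop_apply \<delta> (g *s w))" for g
    by (simp add: pairing_mfps_act_vec[OF hom] pairing_inv_Psi[OF assms] dop_apply_def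
        is_ring_hom_simps[OF hom] mult.commute)
  then show ?thesis
    using pairing_nondegenerate[OF hom, of ?P] pairing_0_right by metis
qed

theorem mainTheorem4:
  fixes \<pp> :: "('n::finite, 'k::field_char_0) mpoly set"
    and loc :: "('n, 'k) mpoly \<Rightarrow> 'l::comm_ring_1"
    and res :: "'l \<Rightarrow> 'f::field"
    and \<delta> :: "nat \<Rightarrow> ('n, 'k, 'r::finite) dop"
    and m :: nat
  assumes "prime_ideal \<pp>"
    and "is_residue_field \<pp> loc res"
    and "\<forall>i\<in>{1..m}. \<delta> i \<in> weyl_vecs"
  shows "let \<iota> = res \<circ> loc;
             A = (\<lambda>i. inv (Psi \<iota>) (Phi \<iota> (\<delta> i)));
             V = inverse_system (A ` {1..m});
             N = Gam \<iota> -` V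
         in N = {w. \<forall>\<epsilon>\<in>bimodule_gen (\<delta> ` {1..m}). dop_apply \<epsilon> w \<in> \<pp>}
            \<and> module.subspace (*s) N
            \<and> ((\<exists>i\<in>{1..m}. A i \<noteq> 0) \<longrightarrow> primary_submodule \<pp> N)"
proof -
  define \<iota> where "\<iota> = res \<circ> loc"
  define A :: "nat \<Rightarrow> ('n, 'f) mpoly ^ 'r" where "A = (\<lambda>i. inv (Psi \<iota>) (Phi \<iota> (\<delta> i)))"
  define N where "N = Gam \<iota> -` inverse_system (A ` {1..m})"
  have hom: "is_ring_hom \<iota>" and ker: "\<iota> a = 0 \<longleftrightarrow> a \<in> \<pp>" for a
    using residue_field_map[OF assms(2,1)] by (simp_all add: \<iota>_def)
  have ideal: "module.subspace (*) \<pp>" using assms(1) by (simp add: prime_ideal_def)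
  have "N = {w. \<forall>\<epsilon>\<in>bimodule_gen (\<delta> ` {1..m}). dop_apply \<epsilon> w \<in> \<pp>}"
    using assms(3)
    by (auto simp: N_def A_def inverse_system_def bimodule_gen_apply_in_ideal_iff[OF ideal]
        mfps_act_vec_inv_Psi_eq_0_iff[OF hom] ker)
  moreover have "module.subspace (*s) N"
    unfolding N_def by (rule subspace_Gam_vimage[OF hom])
  moreover have "primary_submodule \<pp> N" if "\<exists>i\<in>{1..m}. A i \<noteq> 0"
    using primary_submodule_Gam_vimage[OF hom, of "A ` {1..m}"] that by (simp add: N_def ker)
  ultimately show ?thesis
    unfolding Let_def \<iota>_def[symmetric] A_def[symmetric] N_def[symmetric] by (simp add: A_def)
qed

end
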